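(* Let $Z=m_1P_1+\cdots+m_sP_s$ be a set of fat points in $\mathbb{P}^n\times\mathbb{P}^m$, let $P_i\in\operatorname{Supp}(Z)$, and let $Z'=m_1P_1+\cdots+(m_i-1)P_i+\cdots+m_sP_s$. Suppose that $Z$ is arithmetically Cohen-Macaulay, so that the minimal $\mathbb{N}^2$-graded free resolution of $R/I_Z$ has the form \[0\rightarrow \mathbb{F}_N\rightarrow\cdots\rightarrow\mathbb{F}_1\rightarrow R\rightarrow R/I_Z\rightarrow 0\] where $N=n+m$. If $Z'$ is arithmetically Cohen-Macaulay, then \[\mathbb{F}_N = R(-\underline{d}_1-\underline{N})\oplus\cdots\oplus R(-\underline{d}_p-\underline{N})\oplus\mathbb{F}'_N\] for some bigraded free $R$-module $\mathbb{F}'_N$, where $\deg_Z(P_i)=(\underline{d}_1,\ldots,\underline{d}_p)$ and $\underline{N}=(n,m)$.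
   Context: Let $k$ be an algebraically closed field of characteristic zero and $n,m$ positive integers. Let $R=k[x_0,\ldots,x_n,y_0,\ldots,y_m]$ be the $\mathbb{N}^2$-graded coordinate ring of $\mathbb{P}^n\times\mathbb{P}^m$, with $\deg x_i=(1,0)$ and $\deg y_i=(0,1)$. For a point $P\in\mathbb{P}^n\times\mathbb{P}^m$, $I_P\subseteq R$ is its bihomogeneous defining prime ideal. Fat points: for distinct points $P_1,\ldots,P_s$ and positive integers $m_1,\ldots,m_s$, the fat point scheme (set of fat points) $Z=m_1P_1+\cdots+m_sP_s$ is the scheme defined by $I_Z=I_{P_1}^{m_1}\cap\cdots\cap I_{P_s}^{m_s}$; $\operatorname{Supp}(Z)=\{P_1,\ldots,P_s\}$. $Z$ is arithmetically Cohen-Macaulay (ACM) if $\dim R/I_Z=2=\operatorname{depth} R/I_Z$. In $Z'$, if $m_i=1$ the point $P_i$ is dropped (the ideal of the empty scheme is $R$). A bar denotes the class in $R/I_Z$. Minimal separators: a finite set of bihomogeneous forms $\{F_1,\ldots,F_p\}\subseteq R$ is a set of minimal separators of $P_i$ of multiplicity $m_i$ if $I_{Z'}/I_Z=(\overline{F}_1,\ldots,\overline{F}_p)$ as an ideal of $R/I_Z$, and there is no set $\{G_1,\ldots,G_q\}$ with $q<p$ such that $I_{Z'}/I_Z=(\overline{G}_1,\ldots,\overline{G}_q)$. Degree: fix any total ordering $\leq$ on $\mathbb{N}^2$. The degree of the minimal separators of $P_i$ of multiplicity $m_i$ is $\deg_Z(P_i):=(\deg F_1,\ldots,\deg F_p)$,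 a tuple of elements of $\mathbb{N}^2$, where $\{F_1,\ldots,F_p\}$ is any set of minimal separators of $P_i$ of multiplicity $m_i$ labelled so that $\deg F_1\leq\cdots\leq\deg F_p$; it does not depend on the choice of the set of minimal separators. $R(-\underline{a})$ denotes the bigraded shift, i.e. the free module with one generator in degree $\underline{a}$. *)

theory Defs
  imports
    "HOL-Library.Poly_Mapping"
    "HOL-Library.Product_Plus"
    "HOL-Library.Extended_Nat"
    "HOL-Library.Cardinality"
    "HOL-Algebra.QuotRing"
    "HOL-Algebra.Ideal_Product"
    "HOL-Algebra.Algebraic_Closure_Type"
begin

section \<open>The bigraded coordinate ring\<close>

text \<open>
  The variables \<open>x\<^sub>0, \<dots>, x\<^sub>n\<close> are indexed by a finite type \<open>'n\<close> with \<open>n + 1\<close> elements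
  (as \<open>Inl i\<close>) and \<open>y\<^sub>0, \<dots>, y\<^sub>m\<close> by a finite type \<open>'m\<close> with \<open>m + 1\<close> elements
  (as \<open>Inr j\<close>).  A monomial is a finitely supported exponent function, a polynomial a
  finitely supported coefficient function on monomials.
\<close>

type_synonym ('n, 'm) monom = "('n + 'm) \<Rightarrow>\<^sub>0 nat"
type_synonym ('k, 'n, 'm) bipoly = "('n, 'm) monom \<Rightarrow>\<^sub>0 'k"
type_synonym bideg = "nat \<times> nat"

abbreviation coord_ring :: "('k::field, 'n, 'm) bipoly ring"
  where "coord_ring \<equiv> ring_of_type_algebra"

definition variable :: "'n + 'm \<Rightarrow> ('k::field, 'n, 'm) bipoly"
  where "variable z = Poly_Mapping.single (Poly_Mapping.single z 1) 1"

definition irrelevant_ideal :: "('k::field, 'n, 'm) bipoly set"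
  where "irrelevant_ideal = Idl\<^bsub>coord_ring\<^esub> (range variable)"

definition monom_deg :: "('n::finite, 'm::finite) monom \<Rightarrow> bideg"
  where "monom_deg t =
    (\<Sum>i\<in>UNIV. Poly_Mapping.lookup t (Inl i), \<Sum>j\<in>UNIV. Poly_Mapping.lookup t (Inr j))"

text \<open>The bihomogeneous forms of degree \<open>d\<close>; the zero form belongs to every degree.\<close>

definition forms :: "bideg \<Rightarrow> ('k::field, 'n::finite, 'm::finite) bipoly set"
  where "forms d = {f. \<forall>t\<in>Poly_Mapping.keys f. monom_deg t = d}"

definition eval_at :: "('k::field, 'n::finite, 'm::finite) bipoly \<Rightarrow> ('n \<Rightarrow> 'k) \<Rightarrow> ('m \<Rightarrow> 'k) \<Rightarrow> 'k"
  where "eval_at f a b = (\<Sum>t\<in>Poly_Mapping.keys f. Poly_Mapping.lookup f t *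
    (\<Prod>i\<in>UNIV. a i ^ Poly_Mapping.lookup t (Inl i)) *
    (\<Prod>j\<in>UNIV. b j ^ Poly_Mapping.lookup t (Inr j)))"


section \<open>Points and fat points\<close>

text \<open>A projective point is the class of all its homogeneous coordinate vectors.\<close>

definition proj_space :: "('i \<Rightarrow> 'k::field) set set"
  where "proj_space =
    {v. v \<noteq> (\<lambda>_. 0)} // {(v, w). v \<noteq> (\<lambda>_. 0) \<and> (\<exists>c. c \<noteq> 0 \<and> w = (\<lambda>i. c * v i))}"

type_synonym ('k, 'n, 'm) bipoint = "('n \<Rightarrow> 'k) set \<times> ('m \<Rightarrow> 'k) set"

definition biproj_space :: "('k::field, 'n, 'm) bipoint set"
  where "biproj_space = proj_space \<times> proj_space"

definition point_ideal :: "('k::field, 'n::finite, 'm::finite) bipoint \<Rightarrow> ('k, 'n, 'm) bipoly set"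
  where "point_ideal P = Idl\<^bsub>coord_ring\<^esub>
    {f. (\<exists>d. f \<in> forms d) \<and> (\<forall>a\<in>fst P. \<forall>b\<in>snd P. eval_at f a b = 0)}"

text \<open>
  The ideal of \<open>\<mu> 1 P 1 + \<dots> + \<mu> s P s\<close>.  Powers are taken in the monoid of ideals, so a
  point of multiplicity 0 contributes the unit ideal, i.e. it is dropped.
\<close>

definition fat_ideal ::
  "nat \<Rightarrow> (nat \<Rightarrow> ('k::field, 'n::finite, 'm::finite) bipoint) \<Rightarrow> (nat \<Rightarrow> nat) \<Rightarrow> ('k, 'n, 'm) bipoly set"
  where "fat_ideal s P \<mu> = (\<Inter>j\<in>{1..s}. point_ideal (P j) [^]\<^bsub>ideals_set coord_ring\<^esub> \<mu> j)"


section \<open>Dimension, depth, arithmetically Cohen-Macaulay\<close>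

text \<open>The zero ring gets dimension 0 here, since \<open>Sup {} = 0\<close> in \<^typ>\<open>enat\<close>.\<close>

definition krull_dim :: "('a, 'b) ring_scheme \<Rightarrow> enat"
  where "krull_dim A = Sup {enat l | l. \<exists>C :: nat \<Rightarrow> 'a set.
    (\<forall>j\<le>l. primeideal (C j) A) \<and> (\<forall>j<l. C j \<subset> C (Suc j))}"

text \<open>
  \<open>f\<^sub>1, \<dots>, f\<^sub>r\<close> is a regular sequence on the module \<open>M = R/I\<close>; here
  \<open>M/(f\<^sub>1, \<dots>, f\<^sub>j)M = R/J\<close> with \<open>J = I + (f\<^sub>1, \<dots>, f\<^sub>j)\<close>.
\<close>

definition regular_seq_on_quot :: "('k::field, 'n, 'm) bipoly set \<Rightarrow> ('k, 'n, 'm) bipoly list \<Rightarrow> bool"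
  where "regular_seq_on_quot I fs \<longleftrightarrow>
    (\<forall>j<length fs. let J = Idl\<^bsub>coord_ring\<^esub> (I \<union> set (take j fs)); A = coord_ring Quot J in
       \<forall>y\<in>carrier A. (J +>\<^bsub>coord_ring\<^esub> (fs ! j)) \<otimes>\<^bsub>A\<^esub> y = \<zero>\<^bsub>A\<^esub> \<longrightarrow> y = \<zero>\<^bsub>A\<^esub>) \<and>
    Idl\<^bsub>coord_ring\<^esub> (I \<union> set fs) \<noteq> UNIV"

definition depth_quot :: "('k::field, 'n, 'm) bipoly set \<Rightarrow> enat"
  where "depth_quot I = Sup {enat (length fs) | fs.
    set fs \<subseteq> irrelevant_ideal \<and> regular_seq_on_quot I fs}"

definition ACM :: "('k::field, 'n, 'm) bipoly set \<Rightarrow> bool"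
  where "ACM I \<longleftrightarrow> krull_dim (coord_ring Quot I) = 2 \<and> depth_quot I = 2"


section \<open>Minimal separators and their degree\<close>

definition quot_generators ::
  "('k::field, 'n, 'm) bipoly set \<Rightarrow> ('k, 'n, 'm) bipoly set \<Rightarrow> ('k, 'n, 'm) bipoly set \<Rightarrow> bool"
  where "quot_generators I I' S \<longleftrightarrow>
    Idl\<^bsub>coord_ring Quot I\<^esub> ((\<lambda>f. I +>\<^bsub>coord_ring\<^esub> f) ` S) = (\<lambda>f. I +>\<^bsub>coord_ring\<^esub> f) ` I'"

definition minimal_separators ::
  "('k::field, 'n::finite, 'm::finite) bipoly set \<Rightarrow> ('k, 'n, 'm) bipoly set \<Rightarrow> ('k, 'n, 'm) bipoly set \<Rightarrow> bool"
  where "minimal_separators I I' S \<longleftrightarrow>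
    finite S \<and> (\<forall>f\<in>S. \<exists>d. f \<in> forms d) \<and> quot_generators I I' S \<and>
    \<not> (\<exists>T. finite T \<and> card T < card S \<and> quot_generators I I' T)"

text \<open>
  \<open>ds = (deg F\<^sub>1, \<dots>, deg F\<^sub>p)\<close> for some set of minimal separators, labelled increasingly for
  the total order \<open>le_deg\<close>.  By minimality no separator is zero, so each degree is determined.
\<close>

definition separators_degree ::
  "bideg rel \<Rightarrow> ('k::field, 'n::finite, 'm::finite) bipoly set \<Rightarrow> ('k, 'n, 'm) bipoly set \<Rightarrow> bideg list \<Rightarrow> bool"
  where "separators_degree le_deg I I' ds \<longleftrightarrow>
    (\<exists>Fs. distinct Fs \<and> minimal_separators I I' (set Fs) \<and>
      list_all2 (\<lambda>f d. f \<in> forms d) Fs ds \<and> sorted_wrt (\<lambda>d e. (d, e) \<in> le_deg) ds)"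


section \<open>Bigraded free modules and resolutions\<close>

text \<open>
  The list \<open>[a\<^sub>0, \<dots>, a\<^sub>r\<^sub>-\<^sub>1]\<close> stands for the free module \<open>R(-a\<^sub>0) \<oplus> \<dots> \<oplus> R(-a\<^sub>r\<^sub>-\<^sub>1)\<close>, whose elements
  are the vectors in \<open>R\<^sup>r\<close>, extended by zero.  Concatenation of lists is the direct sum, and
  \<open>[]\<close> is the zero module.
\<close>

definition free_mod :: "bideg list \<Rightarrow> (nat \<Rightarrow> ('k::field, 'n, 'm) bipoly) set"
  where "free_mod as = {v. \<forall>u\<ge>length as. v u = 0}"

text \<open>The component of degree \<open>d\<close>, using \<open>R(-a)\<^sub>d = R\<^sub>d\<^sub>-\<^sub>a\<close>, which is zero unless \<open>a \<le> d\<close>.\<close>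

definition free_mod_part ::
  "bideg list \<Rightarrow> bideg \<Rightarrow> (nat \<Rightarrow> ('k::field, 'n::finite, 'm::finite) bipoly) set"
  where "free_mod_part as d = {v \<in> free_mod as.
    \<forall>u<length as. v u = 0 \<or> (\<exists>e. d = as ! u + e \<and> v u \<in> forms e)}"

definition bigraded_hom ::
  "bideg list \<Rightarrow> bideg list \<Rightarrow>
   ((nat \<Rightarrow> ('k::field, 'n::finite, 'm::finite) bipoly) \<Rightarrow> (nat \<Rightarrow> ('k, 'n, 'm) bipoly)) \<Rightarrow> bool"
  where "bigraded_hom as bs \<phi> \<longleftrightarrow>
    \<phi> ` free_mod as \<subseteq> free_mod bs \<and>
    (\<forall>v\<in>free_mod as. \<forall>w\<in>free_mod as. \<phi> (\<lambda>u. v u + w u) = (\<lambda>u. \<phi> v u + \<phi> w u)) \<and>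
    (\<forall>r. \<forall>v\<in>free_mod as. \<phi> (\<lambda>u. r * v u) = (\<lambda>u. r * \<phi> v u)) \<and>
    (\<forall>d. \<phi> ` free_mod_part as d \<subseteq> free_mod_part bs d)"

definition bigraded_iso ::
  "bideg list \<Rightarrow> bideg list \<Rightarrow>
   ((nat \<Rightarrow> ('k::field, 'n::finite, 'm::finite) bipoly) \<Rightarrow> (nat \<Rightarrow> ('k, 'n, 'm) bipoly)) \<Rightarrow> bool"
  where "bigraded_iso as bs \<phi> \<longleftrightarrow>
    bigraded_hom as bs \<phi> \<and> bij_betw \<phi> (free_mod as) (free_mod bs)"

text \<open>
  \<open>\<dots> \<rightarrow> F 2 \<rightarrow> F 1 \<rightarrow> F 0 = R \<rightarrow> R/I \<rightarrow> 0\<close> is exact, where \<open>\<delta> j : F (j + 1) \<rightarrow> F j\<close> and the last map is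
  the canonical projection; minimality means that the image of \<open>\<delta> j\<close> lies in \<open>\<mm> F j\<close> for the
  irrelevant ideal \<open>\<mm>\<close>.  No bound on the length is imposed: a resolution of length \<open>l\<close> is one
  with \<open>F j = []\<close> for all \<open>j > l\<close>.
\<close>

definition minimal_free_resolution ::
  "('k::field, 'n::finite, 'm::finite) bipoly set \<Rightarrow> (nat \<Rightarrow> bideg list) \<Rightarrow>
   (nat \<Rightarrow> (nat \<Rightarrow> ('k, 'n, 'm) bipoly) \<Rightarrow> (nat \<Rightarrow> ('k, 'n, 'm) bipoly)) \<Rightarrow> bool"
  where "minimal_free_resolution I F \<delta> \<longleftrightarrow>
    F 0 = [(0, 0)] \<and>
    (\<forall>j. bigraded_hom (F (Suc j)) (F j) (\<delta> j)) \<and>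
    \<delta> 0 ` free_mod (F 1) =
      {v \<in> free_mod (F 0). I +>\<^bsub>coord_ring\<^esub> v 0 = \<zero>\<^bsub>coord_ring Quot I\<^esub>} \<and>
    (\<forall>j. \<delta> (Suc j) ` free_mod (F (Suc (Suc j))) =
      {v \<in> free_mod (F (Suc j)). \<delta> j v = (\<lambda>_. 0)}) \<and>
    (\<forall>j. \<forall>v\<in>free_mod (F (Suc j)). \<forall>u. \<delta> j v u \<in> irrelevant_ideal)"

end

(*
  The module I_Z'/I_Z is killed by the ideal I_P of the point P = P_i, and I_P is generated by
  N = n + m linear forms z_1, ..., z_N which, together with a linear form l_1 of degree (1,0) and
  one l_2 of degree (0,1) vanishing at no point of Z, are coordinates of R.  Depth 2 makes l_1, l_2
  a regular sequence on R/I_Z and on R/I_Z': modulo I + (l_1) the form l_2 kills only classes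
  annihilated by a power of the irrelevant ideal, and depth 2 excludes these.

  All homology used is obtained by adding one linear form at a time: if F \<otimes> R/J is exact above
  degree q and z is a nonzerodivisor on R/J, then F \<otimes> R/(J + z) is exact above degree q + 1;
  for l_1 and l_2 the degree does not go up, since they are regular on R/I_Z.
  Hence F \<otimes> k is exact above degree N, and minimality forces F_j = 0 for j > N.

  A separator f of degree d is killed by z_1, ..., z_N.  Iterated connecting maps turn it into
  an element of F_N of degree d + (n,m).  If a combination of these elements lies in the
  irrelevant ideal times F_N, undoing the connecting maps modulo (l_1, l_2) puts the combination of the
  separators into I_Z + (l_1, l_2).  As l_1, l_2 is regular on R/I_Z', it then lies in
  I_Z + (l_1, l_2) I_Z', and Nakayama's lemma contradicts the minimality of the set of separators.  So
  F_N has at least as many generators of each degree D as there are separators of degree D - (n,m).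
*)

theory Submission
  imports Defs "HOL-Combinatorics.List_Permutation"
begin

section \<open>Ideals as submodules\<close>

text \<open>In the language of derived functors the computation takes place in Tor_N(R/I_Z, k). Here
  it is done with explicit vectors of polynomials, and two different reductions are needed. On the
  way up only the z_j are divided out: they form a regular sequence on R and kill the separator. On
  the way down (l_1, l_2) is divided out beforehand, so that the last ideal is the whole irrelevant
  ideal and vanishing in F_N tensor k is exactly the hypothesis available. The z_j stay regular in
  both situations because all l and z belong to one coordinate system.

  The shift (n,m) is the sum of the degrees of the z_j: n of them have degree (1,0) and m have
  degree (0,1). Each lift is replaced by its component of the expected degree. Only then can the
  generators be compared one degree at a time, and the comparison becomes linear algebra over k with
  the constant terms of the vectors.

  The forms l_1 and l_2 must miss all points at once. They exist because k is infinite, and they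
  reduce powers of point ideals to powers of ideals generated by variables.\<close>

interpretation idl: Modules.module "(*) :: 'a::comm_ring_1 \<Rightarrow> 'a \<Rightarrow> 'a"
  by standard (auto simp: algebra_simps)

text \<open>With scaling equal to multiplication, this rule is associativity read backwards and
  would loop with \<open>mult.assoc\<close>.\<close>

declare idl.scale_scale [simp del]

lemma type_algebra_sel:
  "carrier ring_of_type_algebra = (UNIV :: 'a::comm_ring_1 set)"
  "x \<otimes>\<^bsub>ring_of_type_algebra\<^esub> y = x * (y :: 'a)"
  "x \<oplus>\<^bsub>ring_of_type_algebra\<^esub> y = x + (y :: 'a)"
  by (simp_all add: ring_of_type_algebra_def)

lemma ideal_type_algebra_iff:
  fixes J :: "'a::comm_ring_1 set"
  shows "ideal J ring_of_type_algebra \<longleftrightarrow> idl.subspace J"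
proof
  interpret R: cring "ring_of_type_algebra :: 'a ring" by (rule cring_from_type_algebra)
  assume "ideal J ring_of_type_algebra"
  then interpret ideal J "ring_of_type_algebra :: 'a ring" .
  show "idl.subspace J"
    unfolding idl.subspace_def
    using zero_closed a_closed I_l_closed by (auto simp: ring_of_type_algebra_def)
next
  interpret R: cring "ring_of_type_algebra :: 'a ring" by (rule cring_from_type_algebra)
  assume J: "idl.subspace J"
  have *: "a * x \<in> J" if "a \<in> J" for a x
    using idl.subspace_scale[OF J that, of x] by (simp add: mult.commute)
  show "ideal J ring_of_type_algebra"
  proof (rule idealI)
    show "ring (ring_of_type_algebra :: 'a ring)" by (rule ring_from_type_algebra)
    show "subgroup J (add_monoid (ring_of_type_algebra :: 'a ring))"
    proof (rule R.add.subgroupI)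
      fix a :: 'a assume "a \<in> J"
      have "\<ominus>\<^bsub>ring_of_type_algebra\<^esub> a = - a"
        by (rule R.minus_equality) (auto simp: ring_of_type_algebra_def)
      then show "\<ominus>\<^bsub>ring_of_type_algebra\<^esub> a \<in> J"
        using idl.subspace_neg[OF J \<open>a \<in> J\<close>] by simp
    qed (use J in \<open>auto simp: ring_of_type_algebra_def idl.subspace_def\<close>)
  qed (use J * in \<open>auto simp: ring_of_type_algebra_def idl.subspace_def\<close>)
qed

lemma subspace_ideal_prod:
  assumes "idl.subspace I" "idl.subspace J"
  shows "idl.subspace (ideal_prod ring_of_type_algebra I J)"
  using ring.ideal_prod_is_ideal[OF ring_from_type_algebra] assms
  unfolding ideal_type_algebra_iff[symmetric] by blast

lemma genideal_type_algebra:
  fixes S :: "'a::comm_ring_1 set"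
  shows "Idl\<^bsub>ring_of_type_algebra\<^esub> S = idl.span S"
  unfolding genideal_def idl.span_def hull_def ideal_type_algebra_iff
  by (simp add: conj_commute)

lemma a_r_coset_type_algebra:
  fixes J :: "'a::comm_ring_1 set"
  shows "J +>\<^bsub>ring_of_type_algebra\<^esub> a = (\<lambda>h. h + a) ` J"
  by (auto simp: a_r_coset_def' ring_of_type_algebra_def)

lemma coset_eq_iff:
  fixes J :: "'a::comm_ring_1 set"
  assumes "idl.subspace J"
  shows "(\<lambda>h. h + a) ` J = (\<lambda>h. h + b) ` J \<longleftrightarrow> a - b \<in> J"
proof
  assume *: "(\<lambda>h. h + a) ` J = (\<lambda>h. h + b) ` J"
  have "a \<in> (\<lambda>h. h + a) ` J" using idl.subspace_0[OF assms] by force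
  then show "a - b \<in> J" unfolding * by auto
next
  assume ab: "a - b \<in> J"
  show "(\<lambda>h. h + a) ` J = (\<lambda>h. h + b) ` J"
  proof (intro equalityI subsetI)
    fix x assume "x \<in> (\<lambda>h. h + a) ` J"
    then obtain h where "h \<in> J" "x = h + a" by auto
    then have "x = (h + (a - b)) + b" "h + (a - b) \<in> J"
      using idl.subspace_add[OF assms _ ab] by auto
    then show "x \<in> (\<lambda>h. h + b) ` J" by blast
  next
    fix x assume "x \<in> (\<lambda>h. h + b) ` J"
    then obtain h where "h \<in> J" "x = h + b" by auto
    then have "x = (h - (a - b)) + a" "h - (a - b) \<in> J"
      using idl.subspace_diff[OF assms _ ab] by auto
    then show "x \<in> (\<lambda>h. h + a) ` J" by blast
  qed
qed

lemma coset_zero_iff: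
  fixes J :: "'a::comm_ring_1 set"
  assumes "idl.subspace J"
  shows "J +>\<^bsub>ring_of_type_algebra\<^esub> a = \<zero>\<^bsub>ring_of_type_algebra Quot J\<^esub> \<longleftrightarrow> a \<in> J"
proof -
  have "\<zero>\<^bsub>ring_of_type_algebra Quot J\<^esub> = (\<lambda>h. h + 0) ` J"
    by (simp add: FactRing_def)
  then show ?thesis
    using coset_eq_iff[OF assms, of a 0] by (simp add: a_r_coset_type_algebra)
qed

lemma idl_span_insert_iff:
  "x \<in> idl.span (insert z S) \<longleftrightarrow> (\<exists>c\<in>idl.span S. \<exists>b. x = c + z * b)"
proof -
  have "(\<exists>k. x - k * z \<in> idl.span S) \<longleftrightarrow> (\<exists>c\<in>idl.span S. \<exists>b. x = c + z * b)"
    by (metis add_diff_cancel_right' diff_add_cancel mult.commute)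
  then show ?thesis unfolding idl.span_breakdown_eq .
qed

lemma idl_span_insert_span: "idl.span (insert z (idl.span S)) = idl.span (insert z S)"
  by (auto simp: idl.span_breakdown_eq idl.span_span)

lemma idl_span_Un_span: "idl.span (A \<union> idl.span B) = idl.span (A \<union> B)"
  by (simp add: idl.span_Un idl.span_span)

lemma idl_span_insert_subspace_iff:
  assumes "idl.subspace J"
  shows "x \<in> idl.span (insert z J) \<longleftrightarrow> (\<exists>b. x - z * b \<in> J)"
  unfolding idl.span_breakdown_eq iffD2[OF idl.span_eq_iff assms] by (simp add: mult.commute)

lemma idl_span_Un_subspace_iff:
  assumes "idl.subspace I"
  shows "x \<in> idl.span (I \<union> S) \<longleftrightarrow> (\<exists>a\<in>I. \<exists>b\<in>idl.span S. x = a + b)"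
  using idl.span_Un[of I S] iffD2[OF idl.span_eq_iff assms] by auto

lemma idl_cong_mult:
  assumes J: "idl.subspace J" and "a - a' \<in> J" "b - b' \<in> J"
  shows "a * b - a' * b' \<in> J"
proof -
  have "a * b - a' * b' = b * (a - a') + a' * (b - b')" by (simp add: algebra_simps)
  then show ?thesis using idl.subspace_scale[OF J] idl.subspace_add[OF J] assms(2,3) by metis
qed

lemma idl_cong_power:
  assumes J: "idl.subspace J" and "a - a' \<in> J"
  shows "a ^ k - a' ^ k \<in> J"
  by (induction k) (use assms idl.subspace_0[OF J] in \<open>auto intro: idl_cong_mult\<close>)

lemma idl_cong_prod:
  assumes J: "idl.subspace J" and "\<And>x. x \<in> A \<Longrightarrow> f x - g x \<in> J"
  shows "prod f A - prod g A \<in> J"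
  using assms(2)
  by (induction A rule: infinite_finite_induct) (auto intro: idl_cong_mult[OF J] simp: idl.subspace_0[OF J])

text \<open>Each inclusion is an instance of minimality: the image of
  \<open>idl.span (I \<union> S)\<close> under the surjective projection is an ideal, and the
  preimage of the ideal generated in the quotient is an ideal containing \<open>I\<close> and
  \<open>S\<close>.\<close>

lemma genideal_Quot:
  fixes I :: "'a::comm_ring_1 set"
  assumes I: "idl.subspace I"
  shows "Idl\<^bsub>ring_of_type_algebra Quot I\<^esub> ((\<lambda>f. I +>\<^bsub>ring_of_type_algebra\<^esub> f) ` S) =
    (\<lambda>f. I +>\<^bsub>ring_of_type_algebra\<^esub> f) ` idl.span (I \<union> S)"
    (is "Idl\<^bsub>?Q\<^esub> (?c ` S) = _")
proof -
  let ?R = "ring_of_type_algebra :: 'a ring"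
  have idI: "ideal I ?R" using I by (simp add: ideal_type_algebra_iff)
  interpret R: cring ?R by (rule cring_from_type_algebra)
  interpret I: ideal I ?R by (rule idI)
  interpret Q: cring ?Q by (rule I.quotient_is_cring[OF R.is_cring])
  have hom: "?c \<in> ring_hom ?R ?Q" by (rule I.rcos_ring_hom)
  interpret h: ring_hom_ring ?R ?Q ?c by (rule I.rcos_ring_hom_ring)
  have carr: "carrier ?Q = range ?c"
    by (auto simp: FactRing_def A_RCOSETS_def' ring_of_type_algebra_def)
  show ?thesis
  proof (intro equalityI)
    have "ideal (?c ` idl.span (I \<union> S)) ?Q"
    proof (rule idealI)
      show "ring ?Q" by (rule Q.ring_axioms)
      show "subgroup (?c ` idl.span (I \<union> S)) (add_monoid ?Q)"
        by (rule group_hom.subgroup_img_is_subgroup[OF h.a_group_hom])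
           (use ideal_type_algebra_iff idl.subspace_span in
             \<open>blast intro: additive_subgroup.a_subgroup ideal.axioms(1)\<close>)
    next
      fix a x assume "a \<in> ?c ` idl.span (I \<union> S)" "x \<in> carrier ?Q"
      then obtain f r where fr: "a = ?c f" "f \<in> idl.span (I \<union> S)" "x = ?c r"
        unfolding carr by auto
      have "x \<otimes>\<^bsub>?Q\<^esub> a = ?c (r * f)" "a \<otimes>\<^bsub>?Q\<^esub> x = ?c (r * f)"
        using h.hom_mult[of r f] h.hom_mult[of f r] fr
        by (simp_all add: ring_of_type_algebra_def mult.commute)
      then show "x \<otimes>\<^bsub>?Q\<^esub> a \<in> ?c ` idl.span (I \<union> S)" "a \<otimes>\<^bsub>?Q\<^esub> x \<in> ?c ` idl.span (I \<union> S)"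
        using idl.span_scale[OF fr(2)] by auto
    qed
    then show "Idl\<^bsub>?Q\<^esub> (?c ` S) \<subseteq> ?c ` idl.span (I \<union> S)"
      by (rule Q.genideal_minimal) (auto intro: idl.span_base)
  next
    have idS: "ideal (Idl\<^bsub>?Q\<^esub> (?c ` S)) ?Q"
      by (rule Q.genideal_ideal) (auto simp: carr)
    let ?J = "{f. ?c f \<in> Idl\<^bsub>?Q\<^esub> (?c ` S)}"
    have "ideal {f \<in> carrier ?R. ?c f \<in> Idl\<^bsub>?Q\<^esub> (?c ` S)} ?R"
      by (rule h.ideal_vimage[OF idS])
    then have J: "idl.subspace ?J"
      by (simp add: ideal_type_algebra_iff[symmetric] ring_of_type_algebra_def)
    have "I \<subseteq> ?J"
    proof
      fix f assume "f \<in> I"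
      then have "?c f = \<zero>\<^bsub>?Q\<^esub>" by (simp add: coset_zero_iff[OF I])
      then show "f \<in> ?J"
        using additive_subgroup.zero_closed[OF ideal.axioms(1)[OF idS]] by simp
    qed
    moreover have "S \<subseteq> ?J"
      using Q.genideal_self[of "?c ` S"] by (auto simp: carr)
    ultimately have "idl.span (I \<union> S) \<subseteq> ?J"
      by (intro idl.span_minimal J) auto
    then show "?c ` idl.span (I \<union> S) \<subseteq> Idl\<^bsub>?Q\<^esub> (?c ` S)" by auto
  qed
qed

text \<open>Ideals containing \<open>I\<close> are determined by their images in R/I, so generation
  by separators can be tested in R itself.\<close>

lemma quot_generators_iff:
  assumes I: "idl.subspace I" and I': "idl.subspace I'" and sub: "I \<subseteq> I'"
  shows "quot_generators I I' S \<longleftrightarrow> I' = idl.span (I \<union> S)"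
proof -
  have *: "J \<subseteq> K"
    if J: "idl.subspace J" "I \<subseteq> J" and K: "idl.subspace K" "I \<subseteq> K"
      and eq: "(\<lambda>f. I +>\<^bsub>coord_ring\<^esub> f) ` J = (\<lambda>f. I +>\<^bsub>coord_ring\<^esub> f) ` K" for J K
  proof
    fix f assume "f \<in> J"
    then obtain g where g: "g \<in> K" "I +>\<^bsub>coord_ring\<^esub> f = I +>\<^bsub>coord_ring\<^esub> g" using eq by blast
    then have "f - g \<in> I" by (simp add: a_r_coset_type_algebra coset_eq_iff[OF I])
    then have "(f - g) + g \<in> K" using K g(1) by (meson idl.subspace_add subsetD)
    then show "f \<in> K" by simp
  qed
  have IS: "I \<subseteq> idl.span (I \<union> S)" using idl.span_superset by blast
  show ?thesis
    unfolding quot_generators_def genideal_Quot[OF I]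
    using *[OF idl.subspace_span IS I' sub] *[OF I' sub idl.subspace_span IS] by auto
qed

section \<open>Nonzerodivisors on quotients and depth\<close>

text \<open>A nonzerodivisor on R/J, phrased without the quotient ring. The condition is vacuous
  when \<open>J\<close> is the whole ring.\<close>

definition nzd :: "'a::comm_ring_1 set \<Rightarrow> 'a \<Rightarrow> bool"
  where "nzd J z \<longleftrightarrow> (\<forall>g. z * g \<in> J \<longrightarrow> g \<in> J)"

lemma nzdD: "nzd J z \<Longrightarrow> z * g \<in> J \<Longrightarrow> g \<in> J"
  by (simp add: nzd_def)

lemma regular_seq_on_quotD:
  assumes "regular_seq_on_quot I fs" "j < length fs"
  shows "nzd (idl.span (I \<union> set (take j fs))) (fs ! j)"
  unfolding nzd_def
proof (intro allI impI)
  fix g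
  let ?J = "idl.span (I \<union> set (take j fs))"
  let ?A = "coord_ring Quot ?J"
  assume "fs ! j * g \<in> ?J"
  have idJ: "ideal ?J coord_ring" by (simp add: ideal_type_algebra_iff)
  interpret R: cring "coord_ring" by (rule cring_from_type_algebra)
  have reg: "\<forall>y\<in>carrier ?A. (?J +>\<^bsub>coord_ring\<^esub> (fs ! j)) \<otimes>\<^bsub>?A\<^esub> y = \<zero>\<^bsub>?A\<^esub> \<longrightarrow> y = \<zero>\<^bsub>?A\<^esub>"
    using assms unfolding regular_seq_on_quot_def Let_def genideal_type_algebra by blast
  have "(?J +>\<^bsub>coord_ring\<^esub> (fs ! j)) \<otimes>\<^bsub>?A\<^esub> (?J +>\<^bsub>coord_ring\<^esub> g) = ?J +>\<^bsub>coord_ring\<^esub> (fs ! j * g)"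
    using ring_hom_mult[OF ideal.rcos_ring_hom[OF idJ], of "fs ! j" g]
    by (simp add: ring_of_type_algebra_def)
  also have "\<dots> = \<zero>\<^bsub>?A\<^esub>"
    using \<open>fs ! j * g \<in> ?J\<close> by (simp add: coset_zero_iff)
  finally have "?J +>\<^bsub>coord_ring\<^esub> g = \<zero>\<^bsub>?A\<^esub>"
    using reg by (auto simp: FactRing_def A_RCOSETS_def' ring_of_type_algebra_def)
  then show "g \<in> ?J" by (simp add: coset_zero_iff)
qed

text \<open>If every regular sequence had length at most 1, the supremum would be at most 1. The
  first two members of a longer sequence are taken.\<close>

lemma depth_2_regular:
  assumes "depth_quot I = 2" and I: "idl.subspace I"
  obtains f1 f2 where "f1 \<in> irrelevant_ideal" "f2 \<in> irrelevant_ideal"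
    "nzd I f1" "nzd (idl.span (insert f1 I)) f2"
proof -
  have "\<not> (\<forall>fs. set fs \<subseteq> irrelevant_ideal \<and> regular_seq_on_quot I fs \<longrightarrow> length fs \<le> 1)"
  proof
    assume "\<forall>fs. set fs \<subseteq> irrelevant_ideal \<and> regular_seq_on_quot I fs \<longrightarrow> length fs \<le> 1"
    then have "depth_quot I \<le> 1"
      unfolding depth_quot_def by (intro Sup_least) (auto simp: one_enat_def)
    then have "(2::enat) \<le> 1" using assms(1) by simp
    then show False by (simp add: one_enat_def numeral_eq_enat)
  qed
  then obtain fs where fs: "set fs \<subseteq> irrelevant_ideal" "regular_seq_on_quot I fs" "1 < length fs"
    by (auto simp: not_le)
  then obtain f1 f2 gs where "fs = f1 # f2 # gs"
    by (metis One_nat_def Suc_less_eq2 length_Suc_conv_rev length_greater_0_conv list.exhaust list.size(3,4)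
        add.commute less_nat_zero_code plus_1_eq_Suc less_irrefl)
  then show ?thesis
    using that[of f1 f2] fs regular_seq_on_quotD[OF fs(2), of 0] regular_seq_on_quotD[OF fs(2), of 1]
      iffD2[OF idl.span_eq_iff I]
    by simp
qed

section \<open>Polynomials\<close>

lemma poly_sum_monomials:
  "f = (\<Sum>t\<in>Poly_Mapping.keys f. Poly_Mapping.single t (Poly_Mapping.lookup f t))"
  by (rule poly_mapping_eqI)
     (auto simp: lookup_sum lookup_single when_def sum.delta' in_keys_iff cong: if_cong)

text \<open>The zero polynomial is the case \<open>c = 0\<close> of \<open>single\<close>, so
  additive statements need only be checked on single terms.\<close>

lemma poly_single_induct [case_names single add]:
  fixes f :: "'a \<Rightarrow>\<^sub>0 'b::comm_monoid_add"
  assumes "\<And>t c. Q (Poly_Mapping.single t c)" "\<And>f g. Q f \<Longrightarrow> Q g \<Longrightarrow> Q (f + g)"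
  shows "Q f"
proof -
  have *: "Q (\<Sum>t\<in>A. Poly_Mapping.single t (Poly_Mapping.lookup f t))" if "finite A" for A
    using that
  proof (induction A)
    case empty
    then show ?case using assms(1)[of _ 0] by simp
  qed (use assms in auto)
  show ?thesis by (subst poly_sum_monomials) (simp add: *)
qed

lemma lookup_single_times:
  fixes f :: "('v \<Rightarrow>\<^sub>0 nat) \<Rightarrow>\<^sub>0 'k::field"
  shows "Poly_Mapping.lookup (Poly_Mapping.single s 1 * f) (s + t) = Poly_Mapping.lookup f t"
  by (induction f rule: poly_single_induct)
     (auto simp: mult_single lookup_single when_def distrib_left lookup_add)

abbreviation cst :: "'k::field \<Rightarrow> ('v \<Rightarrow>\<^sub>0 nat) \<Rightarrow>\<^sub>0 'k"
  where "cst \<equiv> Poly_Mapping.single 0"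

lemma cst_add: "cst (a + b) = cst a + cst b"
  and cst_mult: "cst (a * b) = cst a * cst b"
  by (simp_all add: single_add mult_single)

lemma cst_sum: "cst (sum f A) = (\<Sum>x\<in>A. cst (f x))"
  by (induction A rule: infinite_finite_induct) (simp_all add: single_add)

lemma cst_prod: "cst (prod f A) = (\<Prod>x\<in>A. cst (f x))"
  by (induction A rule: infinite_finite_induct) (simp_all add: cst_mult)

lemma cst_power: "cst (c ^ k) = cst c ^ k"
  by (induction k) (simp_all add: cst_mult)

definition var :: "'v \<Rightarrow> ('v \<Rightarrow>\<^sub>0 nat) \<Rightarrow>\<^sub>0 'k::field"
  where "var v = Poly_Mapping.single (Poly_Mapping.single v 1) 1"

lemma single_eq_prod_var:
  fixes t :: "'v::finite \<Rightarrow>\<^sub>0 nat"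
  shows "Poly_Mapping.single t c = cst c * (\<Prod>v\<in>UNIV. var v ^ Poly_Mapping.lookup t v)"
proof -
  have pow: "var v ^ k = Poly_Mapping.single (Poly_Mapping.single v k) (1::'k::field)"
    for v :: 'v and k
    by (induction k) (simp_all add: var_def mult_single flip: single_add)
  have prod: "(\<Prod>v\<in>A. Poly_Mapping.single (g v) 1) = Poly_Mapping.single (sum g A) (1::'k::field)"
    for A :: "'v set" and g :: "'v \<Rightarrow> 'v \<Rightarrow>\<^sub>0 nat"
    by (induction A rule: infinite_finite_induct) (simp_all add: mult_single)
  have "(\<Sum>v\<in>UNIV. Poly_Mapping.single v (Poly_Mapping.lookup t v)) = t"
    by (rule poly_mapping_eqI) (simp add: lookup_sum lookup_single when_def sum.delta')
  then show ?thesis by (simp add: pow prod mult_single)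
qed

subsection \<open>Evaluation and substitution\<close>

text \<open>One operation for two purposes: with \<open>h\<close> the identity it is evaluation at a
  point, with \<open>h = cst\<close> it is substitution of polynomials for the variables.\<close>

definition ins :: "('k::field \<Rightarrow> 'a::comm_ring_1) \<Rightarrow> ('v::finite \<Rightarrow> 'a) \<Rightarrow> (('v \<Rightarrow>\<^sub>0 nat) \<Rightarrow>\<^sub>0 'k) \<Rightarrow> 'a"
  where "ins h \<sigma> f = (\<Sum>t\<in>Poly_Mapping.keys f.
    h (Poly_Mapping.lookup f t) * (\<Prod>v\<in>UNIV. \<sigma> v ^ Poly_Mapping.lookup t v))"

definition coeff_hom :: "('k::field \<Rightarrow> 'a::comm_ring_1) \<Rightarrow> bool"
  where "coeff_hom h \<longleftrightarrow> h 1 = 1 \<and> (\<forall>a b. h (a + b) = h a + h b) \<and> (\<forall>a b. h (a * b) = h a * h b)"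

lemma coeff_hom_id: "coeff_hom (\<lambda>x. x)" and coeff_hom_cst: "coeff_hom cst"
  by (auto simp: coeff_hom_def cst_add cst_mult)

lemma coeff_hom_0: "coeff_hom h \<Longrightarrow> h 0 = 0"
  unfolding coeff_hom_def by (metis add_cancel_left_left)

lemma ins_single:
  assumes "coeff_hom h"
  shows "ins h \<sigma> (Poly_Mapping.single t c) = h c * (\<Prod>v\<in>UNIV. \<sigma> v ^ Poly_Mapping.lookup t v)"
  by (cases "c = 0") (simp_all add: ins_def coeff_hom_0[OF assms])

lemma ins_add:
  assumes h: "coeff_hom h"
  shows "ins h \<sigma> (f + g) = ins h \<sigma> f + ins h \<sigma> g"
proof -
  let ?A = "Poly_Mapping.keys f \<union> Poly_Mapping.keys g"
  have *: "ins h \<sigma> q = (\<Sum>t\<in>?A. h (Poly_Mapping.lookup q t) * (\<Prod>v\<in>UNIV. \<sigma> v ^ Poly_Mapping.lookup t v))"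
    if "Poly_Mapping.keys q \<subseteq> ?A" for q
    unfolding ins_def using that
    by (intro sum.mono_neutral_left) (auto simp: in_keys_iff coeff_hom_0[OF h])
  have hadd: "h (a + b) = h a + h b" for a b using h by (simp add: coeff_hom_def)
  show ?thesis
    using keys_add[of f g] by (subst (1 2 3) *) (auto simp: lookup_add hadd distrib_right sum.distrib)
qed

lemma ins_0 [simp]: "ins h \<sigma> 0 = 0"
  by (simp add: ins_def)

lemma ins_diff:
  assumes h: "coeff_hom h"
  shows "ins h \<sigma> (f - g) = ins h \<sigma> f - ins h \<sigma> g"
  using ins_add[OF h, of \<sigma> "f - g" g] by simp

lemma ins_sum:
  assumes h: "coeff_hom h"
  shows "ins h \<sigma> (\<Sum>x\<in>A. f x) = (\<Sum>x\<in>A. ins h \<sigma> (f x))"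
  by (induction A rule: infinite_finite_induct) (simp_all add: ins_add[OF h])

lemma ins_mult:
  assumes h: "coeff_hom h"
  shows "ins h \<sigma> (f * g) = ins h \<sigma> f * ins h \<sigma> g"
proof (induction f rule: poly_single_induct)
  case (single s b)
  show ?case
  proof (induction g rule: poly_single_induct)
    case (single t c)
    have hmult: "h (a * b) = h a * h b" for a b using h by (simp add: coeff_hom_def)
    have "ins h \<sigma> (Poly_Mapping.single s b * Poly_Mapping.single t c) = (h b * h c) *
        ((\<Prod>v\<in>UNIV. \<sigma> v ^ Poly_Mapping.lookup s v) * (\<Prod>v\<in>UNIV. \<sigma> v ^ Poly_Mapping.lookup t v))"
      by (simp only: mult_single ins_single[OF h] lookup_add power_add prod.distrib hmult)
    then show ?case unfolding ins_single[OF h] by (simp only: mult_ac)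
  qed (simp add: distrib_left ins_add[OF h])
qed (simp add: distrib_right ins_add[OF h])

lemma ins_cst:
  assumes "coeff_hom h"
  shows "ins h \<sigma> (cst c) = h c"
  by (simp add: ins_single[OF assms])

lemma ins_var:
  assumes "coeff_hom h"
  shows "ins h \<sigma> (var v) = \<sigma> v"
proof -
  have "(\<Prod>w\<in>UNIV. \<sigma> w ^ Poly_Mapping.lookup (Poly_Mapping.single v 1) w) = (\<Prod>w\<in>UNIV. if w = v then \<sigma> w else 1)"
    by (intro prod.cong) (auto simp: lookup_single when_def)
  then show ?thesis using assms by (simp add: var_def ins_single[OF assms] coeff_hom_def)
qed

lemma ins_1:
  assumes "coeff_hom h"
  shows "ins h \<sigma> 1 = 1"
  using ins_cst[OF assms, of \<sigma> 1] assms by (simp add: coeff_hom_def)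

lemma ins_power:
  assumes h: "coeff_hom h"
  shows "ins h \<sigma> (f ^ k) = ins h \<sigma> f ^ k"
  by (induction k) (simp_all add: ins_mult[OF h] ins_1[OF h])

lemma ins_prod:
  assumes h: "coeff_hom h"
  shows "ins h \<sigma> (\<Prod>x\<in>A. f x) = (\<Prod>x\<in>A. ins h \<sigma> (f x))"
  by (induction A rule: infinite_finite_induct) (simp_all add: ins_mult[OF h] ins_1[OF h])

lemmas ins_id_simps =
  ins_add[OF coeff_hom_id] ins_diff[OF coeff_hom_id] ins_sum[OF coeff_hom_id]
  ins_mult[OF coeff_hom_id] ins_cst[OF coeff_hom_id] ins_var[OF coeff_hom_id]

abbreviation subst :: "('v::finite \<Rightarrow> ('v \<Rightarrow>\<^sub>0 nat) \<Rightarrow>\<^sub>0 'k::field) \<Rightarrow> (('v \<Rightarrow>\<^sub>0 nat) \<Rightarrow>\<^sub>0 'k) \<Rightarrow> (('v \<Rightarrow>\<^sub>0 nat) \<Rightarrow>\<^sub>0 'k)"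
  where "subst \<equiv> ins cst"

lemmas subst_simps =
  ins_add[OF coeff_hom_cst] ins_diff[OF coeff_hom_cst] ins_sum[OF coeff_hom_cst]
  ins_mult[OF coeff_hom_cst] ins_cst[OF coeff_hom_cst] ins_var[OF coeff_hom_cst]
  ins_power[OF coeff_hom_cst] ins_prod[OF coeff_hom_cst] ins_single[OF coeff_hom_cst]

lemma subst_inverse:
  assumes "\<And>v. subst \<sigma> (\<tau> v) = var v"
  shows "subst \<sigma> (subst \<tau> f) = f"
proof (induction f rule: poly_single_induct)
  case (single t c)
  then show ?case using assms by (simp add: subst_simps flip: single_eq_prod_var)
qed (simp add: subst_simps)

lemma subst_var: "subst var f = f"
  by (induction f rule: poly_single_induct) (simp_all add: subst_simps flip: single_eq_prod_var)

lemma subst_cong_mod: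
  assumes J: "idl.subspace J" and "\<And>v. \<sigma> v - \<sigma>' v \<in> J"
  shows "subst \<sigma> f - subst \<sigma>' f \<in> J"
proof (induction f rule: poly_single_induct)
  case (single t c)
  show ?case
    unfolding ins_single[OF coeff_hom_cst]
    by (intro idl_cong_mult[OF J] idl_cong_prod[OF J] idl_cong_power[OF J] assms(2))
       (simp add: idl.subspace_0[OF J])
next
  case (add f g)
  have "subst \<sigma> (f + g) - subst \<sigma>' (f + g) = (subst \<sigma> f - subst \<sigma>' f) + (subst \<sigma> g - subst \<sigma>' g)"
    by (simp add: subst_simps)
  then show ?case using idl.subspace_add[OF J add] by simp
qed

subsection \<open>Monomial ideals\<close>

text \<open>This is the \<open>k\<close>-th power of the ideal generated by the variables in
  \<open>W\<close>. Describing it by exponents makes nonzerodivisors visible.\<close>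

definition mon_ideal :: "'v::finite set \<Rightarrow> nat \<Rightarrow> (('v \<Rightarrow>\<^sub>0 nat) \<Rightarrow>\<^sub>0 'k::field) set"
  where "mon_ideal W k = {f. \<forall>t\<in>Poly_Mapping.keys f. k \<le> (\<Sum>w\<in>W. Poly_Mapping.lookup t w)}"

lemma mon_ideal_0 [simp]: "mon_ideal W 0 = UNIV"
  by (simp add: mon_ideal_def)

lemma mon_ideal_add: "f \<in> mon_ideal W k \<Longrightarrow> g \<in> mon_ideal W k \<Longrightarrow> f + g \<in> mon_ideal W k"
  using keys_add[of f g] by (auto simp: mon_ideal_def)

lemma mon_ideal_mult:
  assumes "f \<in> mon_ideal W k" "g \<in> mon_ideal W l"
  shows "f * g \<in> mon_ideal W (k + l)"
proof -
  have "k + l \<le> (\<Sum>w\<in>W. Poly_Mapping.lookup t w)" if t: "t \<in> Poly_Mapping.keys (f * g)" for t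
  proof -
    obtain a b where "t = a + b" "a \<in> Poly_Mapping.keys f" "b \<in> Poly_Mapping.keys g"
      using subsetD[OF keys_mult t] by blast
    then show ?thesis using assms by (auto simp: mon_ideal_def lookup_add sum.distrib intro: add_mono)
  qed
  then show ?thesis by (simp add: mon_ideal_def)
qed

lemma subspace_mon_ideal: "idl.subspace (mon_ideal W k)"
proof (rule idl.subspaceI)
  show "0 \<in> mon_ideal W k" by (simp add: mon_ideal_def)
  show "c * f \<in> mon_ideal W k" if "f \<in> mon_ideal W k" for c f
    using mon_ideal_mult[of c W 0 f k] that by simp
qed (rule mon_ideal_add)

lemma mon_ideal_subsetI:
  fixes J :: "(('v::finite \<Rightarrow>\<^sub>0 nat) \<Rightarrow>\<^sub>0 'k::field) set"
  assumes "idl.subspace J"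
    and "\<And>t c. k \<le> (\<Sum>w\<in>W. Poly_Mapping.lookup t w) \<Longrightarrow> Poly_Mapping.single t c \<in> J"
  shows "mon_ideal W k \<subseteq> J"
proof
  fix f :: "('v \<Rightarrow>\<^sub>0 nat) \<Rightarrow>\<^sub>0 'k" assume "f \<in> mon_ideal W k"
  then have "(\<Sum>t\<in>Poly_Mapping.keys f. Poly_Mapping.single t (Poly_Mapping.lookup f t)) \<in> J"
    by (intro idl.subspace_sum assms) (auto simp: mon_ideal_def)
  then show "f \<in> J" by (subst poly_sum_monomials)
qed

lemma var_in_mon_ideal: "w \<in> W \<Longrightarrow> var w \<in> mon_ideal W (Suc 0)"
  by (auto simp: var_def mon_ideal_def lookup_single when_def)

lemma monomial_split:
  fixes t :: "'v::finite \<Rightarrow>\<^sub>0 nat" and c :: "'k::field"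
  assumes "Suc k \<le> (\<Sum>w\<in>W. Poly_Mapping.lookup t w)"
  obtains w g where "w \<in> W" "g \<in> mon_ideal W k" "Poly_Mapping.single t c = g * var w"
proof -
  obtain w where w: "w \<in> W" "Poly_Mapping.lookup t w > 0"
    using assms by (metis not_gr_zero not_less_eq_eq sum.neutral zero_le)
  let ?s = "t - Poly_Mapping.single w 1"
  have t: "t = ?s + Poly_Mapping.single w 1"
    using w(2) by (intro poly_mapping_eqI) (auto simp: lookup_add lookup_minus lookup_single when_def)
  have "(\<Sum>w\<in>W. Poly_Mapping.lookup t w) = (\<Sum>w\<in>W. Poly_Mapping.lookup ?s w) + 1"
    using w(1) by (subst t) (simp add: lookup_add sum.distrib lookup_single when_def)
  then have "Poly_Mapping.single ?s c \<in> mon_ideal W k"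
    using assms by (auto simp: mon_ideal_def)
  moreover have "Poly_Mapping.single t c = Poly_Mapping.single ?s c * var w"
    using t by (simp add: var_def mult_single)
  ultimately show ?thesis using that w(1) by blast
qed

lemma mon_ideal_1:
  fixes W :: "'v::finite set"
  shows "(mon_ideal W (Suc 0) :: (('v \<Rightarrow>\<^sub>0 nat) \<Rightarrow>\<^sub>0 'k::field) set) = idl.span (var ` W)"
  (is "?M = ?S")
proof (intro equalityI)
  show "?M \<subseteq> ?S"
  proof (rule mon_ideal_subsetI)
    fix t :: "'v \<Rightarrow>\<^sub>0 nat" and c :: 'k
    assume "Suc 0 \<le> (\<Sum>w\<in>W. Poly_Mapping.lookup t w)"
    then show "Poly_Mapping.single t c \<in> idl.span (var ` W)"
      by (elim monomial_split[where c = c]) (auto intro: idl.span_scale idl.span_base)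
  qed simp
  show "?S \<subseteq> ?M"
    by (intro idl.span_minimal subspace_mon_ideal) (auto intro: var_in_mon_ideal)
qed

text \<open>Multiplication by a variable outside \<open>W\<close> shifts the monomials injectively
  and leaves their degree in \<open>W\<close> unchanged.\<close>

lemma nzd_mon_ideal:
  assumes "v \<notin> W"
  shows "nzd (mon_ideal W k) (var v :: ('v::finite \<Rightarrow>\<^sub>0 nat) \<Rightarrow>\<^sub>0 'k::field)"
  unfolding nzd_def
proof (intro allI impI)
  fix g :: "('v \<Rightarrow>\<^sub>0 nat) \<Rightarrow>\<^sub>0 'k"
  assume *: "var v * g \<in> mon_ideal W k"
  have "k \<le> (\<Sum>w\<in>W. Poly_Mapping.lookup t w)" if "t \<in> Poly_Mapping.keys g" for t
  proof -
    have "Poly_Mapping.single v 1 + t \<in> Poly_Mapping.keys (var v * g)"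
      using that unfolding var_def in_keys_iff lookup_single_times .
    then have "k \<le> (\<Sum>w\<in>W. Poly_Mapping.lookup (Poly_Mapping.single v 1 + t) w)"
      using * unfolding mon_ideal_def by blast
    also have "\<dots> = (\<Sum>w\<in>W. Poly_Mapping.lookup t w)"
      using assms by (intro sum.cong) (auto simp: lookup_add lookup_single when_def)
    finally show ?thesis .
  qed
  then show "g \<in> mon_ideal W k" by (simp add: mon_ideal_def)
qed

lemma ideal_prod_mon_ideal:
  fixes W :: "'v::finite set"
  shows "ideal_prod ring_of_type_algebra (mon_ideal W k) (mon_ideal W (Suc 0)) =
    (mon_ideal W (Suc k) :: (('v \<Rightarrow>\<^sub>0 nat) \<Rightarrow>\<^sub>0 'k::field) set)"
    (is "ideal_prod ?R ?I ?J = _")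
proof (intro equalityI subsetI)
  fix f assume "f \<in> ideal_prod ?R ?I ?J"
  then show "f \<in> mon_ideal W (Suc k)"
  proof induction
    case (prod i j)
    then show ?case using mon_ideal_mult[of i W k j "Suc 0"] by (simp add: type_algebra_sel)
  qed (simp add: type_algebra_sel mon_ideal_add)
next
  fix f :: "('v \<Rightarrow>\<^sub>0 nat) \<Rightarrow>\<^sub>0 'k"
  have "idl.subspace (ideal_prod ?R ?I ?J)"
    by (intro subspace_ideal_prod subspace_mon_ideal)
  then have "mon_ideal W (Suc k) \<subseteq> ideal_prod ?R ?I ?J"
  proof (rule mon_ideal_subsetI)
    fix t :: "'v \<Rightarrow>\<^sub>0 nat" and c :: 'k
    assume "Suc k \<le> (\<Sum>w\<in>W. Poly_Mapping.lookup t w)"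
    then obtain w g where "w \<in> W" "g \<in> mon_ideal W k" "Poly_Mapping.single t c = g * var w"
      by (rule monomial_split)
    then show "Poly_Mapping.single t c \<in> ideal_prod ?R ?I ?J"
      using ideal_prod.prod[of g ?I "var w" ?J ?R, OF _ var_in_mon_ideal]
      by (simp add: type_algebra_sel)
  qed
  then show "f \<in> mon_ideal W (Suc k) \<Longrightarrow> f \<in> ideal_prod ?R ?I ?J" by blast
qed

text \<open>Degrees are pairs; quantifiers over them are kept whole instead of being split into
  components.\<close>

declare split_paired_All [simp del] split_paired_Ex [simp del]

subsection \<open>Bihomogeneous components\<close>

lemma variable_eq_var: "variable = var"
  by (auto simp: variable_def var_def)

lemma monom_deg_0 [simp]: "monom_deg 0 = 0"
  by (simp add: monom_deg_def zero_prod_def)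

lemma monom_deg_add: "monom_deg (s + t) = monom_deg s + monom_deg t"
  by (simp add: monom_deg_def lookup_add sum.distrib)

definition var_deg :: "'n + 'm \<Rightarrow> bideg"
  where "var_deg v = (if isl v then (1, 0) else (0, 1))"

lemma monom_deg_single: "monom_deg (Poly_Mapping.single v 1) = var_deg v"
  by (cases v) (simp_all add: monom_deg_def var_deg_def lookup_single when_def)

lemma forms_0 [simp]: "0 \<in> forms d"
  by (simp add: forms_def)

lemma forms_add: "f \<in> forms d \<Longrightarrow> g \<in> forms d \<Longrightarrow> f + g \<in> forms d"
  using keys_add[of f g] by (auto simp: forms_def)

lemma forms_sum: "(\<And>x. x \<in> A \<Longrightarrow> f x \<in> forms d) \<Longrightarrow> sum f A \<in> forms d"
  by (induction A rule: infinite_finite_induct) (auto intro: forms_add)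

lemma forms_mult:
  assumes "f \<in> forms d" "g \<in> forms e"
  shows "f * g \<in> forms (d + e)"
  using assms subsetD[OF keys_mult, of _ f g] by (fastforce simp: forms_def monom_deg_add)

lemma cst_in_forms: "cst c \<in> forms 0"
  by (simp add: forms_def)

lemma var_in_forms: "var v \<in> forms (var_deg v)"
  by (auto simp: forms_def var_def monom_deg_single[simplified])

lemma forms_cst_mult: "f \<in> forms d \<Longrightarrow> cst c * f \<in> forms d"
  using forms_mult[OF cst_in_forms] by fastforce

lemma forms_diff:
  assumes "f \<in> forms d" "g \<in> forms d"
  shows "f - g \<in> forms d"
  using forms_add[OF assms(1) forms_cst_mult[OF assms(2), of "- 1"]] by (simp add: single_uminus)

text \<open>The component of degree \<open>D\<close> of \<open>f\<close> as an element of \<open>R(-a)\<close>.\<close>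

definition hcomp :: "bideg \<Rightarrow> bideg \<Rightarrow> ('k::field, 'n::finite, 'm::finite) bipoly \<Rightarrow> ('k, 'n, 'm) bipoly"
  where "hcomp a D f = Poly_Mapping.mapp (\<lambda>t c. c when a + monom_deg t = D) f"

lemma lookup_hcomp:
  "Poly_Mapping.lookup (hcomp a D f) t = (Poly_Mapping.lookup f t when a + monom_deg t = D)"
  by (auto simp: hcomp_def lookup_mapp when_def in_keys_iff)

lemma hcomp_add: "hcomp a D (f + g) = hcomp a D f + hcomp a D g"
  by (rule poly_mapping_eqI) (simp add: lookup_hcomp lookup_add when_add_distrib)

lemma hcomp_0 [simp]: "hcomp a D 0 = 0"
  by (rule poly_mapping_eqI) (simp add: lookup_hcomp)

lemma hcomp_diff: "hcomp a D (f - g) = hcomp a D f - hcomp a D g"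
  using hcomp_add[of a D "f - g" g] by simp

lemma hcomp_sum: "hcomp a D (\<Sum>x\<in>A. f x) = (\<Sum>x\<in>A. hcomp a D (f x))"
  by (induction A rule: infinite_finite_induct) (simp_all add: hcomp_add)

lemma hcomp_single:
  "hcomp a D (Poly_Mapping.single t c) = (Poly_Mapping.single t c when a + monom_deg t = D)"
  by (rule poly_mapping_eqI) (auto simp: lookup_hcomp lookup_single when_def)

lemma hcomp_form: "f \<in> forms e \<Longrightarrow> hcomp a D f = (f when a + e = D)"
  by (rule poly_mapping_eqI) (auto simp: lookup_hcomp forms_def when_def in_keys_iff)

text \<open>Degrees cannot be subtracted freely in pairs of naturals. If \<open>D\<close> is not of
  the form \<open>a + e\<close>, no monomial qualifies and the component is zero.\<close>

lemma hcomp_cases: "hcomp a D f = 0 \<or> (\<exists>e. D = a + e \<and> hcomp a D f \<in> forms e)"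
proof (cases "\<exists>e. D = a + e")
  case True
  then obtain e where "D = a + e" by blast
  then show ?thesis by (auto simp: forms_def in_keys_iff lookup_hcomp)
next
  case False
  then have "hcomp a D f = 0" by (intro poly_mapping_eqI) (auto simp: lookup_hcomp when_def)
  then show ?thesis by blast
qed

lemma hcomp_in_forms: "hcomp 0 e f \<in> forms e"
  by (auto simp: forms_def in_keys_iff lookup_hcomp)

text \<open>The shift argument of \<open>hcomp\<close> absorbs the degree of \<open>h\<close>, so no
  truncated subtraction of degrees appears. By additivity it suffices to treat monomials.\<close>

lemma hcomp_form_mult:
  assumes "h \<in> forms e"
  shows "hcomp a D (h * f) = h * hcomp (a + e) D f"
proof -
  have single: "hcomp a D (Poly_Mapping.single s b * f) = Poly_Mapping.single s b * hcomp (a + e) D f"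
    if "monom_deg s = e" for s b
    using that
    by (induction f rule: poly_single_induct)
       (simp_all add: mult_single hcomp_single monom_deg_add hcomp_add distrib_left add.assoc when_def)
  have "hcomp a D (h * f) =
      hcomp a D ((\<Sum>s\<in>Poly_Mapping.keys h. Poly_Mapping.single s (Poly_Mapping.lookup h s)) * f)"
    using poly_sum_monomials[of h] by simp
  also have "\<dots> = (\<Sum>s\<in>Poly_Mapping.keys h. Poly_Mapping.single s (Poly_Mapping.lookup h s) * hcomp (a + e) D f)"
    unfolding sum_distrib_right hcomp_sum
    by (intro sum.cong single) (use assms in \<open>auto simp: forms_def\<close>)
  also have "\<dots> = h * hcomp (a + e) D f"
    using poly_sum_monomials[of h] by (simp flip: sum_distrib_right)
  finally show ?thesis .
qed

lemma sum_hcomp: "f = (\<Sum>e\<in>monom_deg ` Poly_Mapping.keys f. hcomp 0 e f)"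
  by (rule poly_mapping_eqI) (auto simp: lookup_sum lookup_hcomp when_def in_keys_iff cong: if_cong)

definition homogeneous :: "('k::field, 'n::finite, 'm::finite) bipoly set \<Rightarrow> bool"
  where "homogeneous J \<longleftrightarrow> (\<forall>f\<in>J. \<forall>a D. hcomp a D f \<in> J)"

lemma homogeneousD: "homogeneous J \<Longrightarrow> f \<in> J \<Longrightarrow> hcomp a D f \<in> J"
  by (simp add: homogeneous_def)

lemma homogeneous_span:
  assumes "\<And>f. f \<in> S \<Longrightarrow> \<exists>d. f \<in> forms d"
  shows "homogeneous (idl.span S)"
  unfolding homogeneous_def
proof (intro ballI allI)
  fix f a D assume "f \<in> idl.span S"
  then show "hcomp a D f \<in> idl.span S"
  proof (induction rule: idl.span_induct_alt)
    case (step c x y)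
    obtain d where "x \<in> forms d" using assms step.hyps by blast
    then have "hcomp a D (c * x + y) = hcomp (a + d) D c * x + hcomp a D y"
      using hcomp_form_mult[of x d a D c] by (simp add: hcomp_add mult.commute)
    then show ?case using step by (simp add: idl.span_add idl.span_scale idl.span_base)
  qed (simp add: idl.span_zero)
qed

lemma homogeneous_ideal_prod:
  assumes "homogeneous I" "homogeneous J" "idl.subspace I" "idl.subspace J"
  shows "homogeneous (ideal_prod ring_of_type_algebra I J)"
  unfolding homogeneous_def
proof (intro ballI allI)
  let ?K = "ideal_prod ring_of_type_algebra I J"
  fix f a D assume "f \<in> ?K"
  have K: "idl.subspace ?K"
    by (intro subspace_ideal_prod assms)
  from \<open>f \<in> ?K\<close> show "hcomp a D f \<in> ?K"
  proof induction
    case (prod i j)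
    have "hcomp a D (i * j) = hcomp a D ((\<Sum>e\<in>monom_deg ` Poly_Mapping.keys i. hcomp 0 e i) * j)"
      using sum_hcomp[of i] by simp
    also have "\<dots> = (\<Sum>e\<in>monom_deg ` Poly_Mapping.keys i. hcomp 0 e i * hcomp (a + e) D j)"
      by (simp add: sum_distrib_right hcomp_sum hcomp_form_mult[OF hcomp_in_forms])
    also have "\<dots> \<in> ?K"
      using prod assms(1,2)
      by (intro idl.subspace_sum[OF K] ideal_prod.prod[of _ I _ J ring_of_type_algebra, unfolded type_algebra_sel])
         (auto simp: homogeneous_def)
    finally show ?case by (simp add: type_algebra_sel)
  next
    case (sum s1 s2)
    then show ?case by (simp add: type_algebra_sel hcomp_add idl.subspace_add[OF K])
  qed
qed

subsection \<open>Linear coordinate systems\<close>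

text \<open>An automorphism of R recorded by the images of the variables, together with its inverse.
  Both send variables into the irrelevant ideal, whence the new coordinates generate the same
  irrelevant ideal.\<close>

definition coords :: "('v::finite \<Rightarrow> ('v \<Rightarrow>\<^sub>0 nat) \<Rightarrow>\<^sub>0 'k::field) \<Rightarrow> bool"
  where "coords \<sigma> \<longleftrightarrow> range \<sigma> \<subseteq> idl.span (range var) \<and>
    (\<exists>\<tau>. range \<tau> \<subseteq> idl.span (range var) \<and> (\<forall>v. subst \<sigma> (\<tau> v) = var v) \<and> (\<forall>v. subst \<tau> (\<sigma> v) = var v))"

lemma surj_hom_image_span:
  fixes \<phi> :: "'a::comm_ring_1 \<Rightarrow> 'b::comm_ring_1"
  assumes add: "\<And>x y. \<phi> (x + y) = \<phi> x + \<phi> y" and mult: "\<And>x y. \<phi> (x * y) = \<phi> x * \<phi> y"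
    and surj: "surj \<phi>"
  shows "\<phi> ` idl.span S = idl.span (\<phi> ` S)"
proof (intro equalityI)
  have zero: "\<phi> 0 = 0" using add[of 0 0] by simp
  have "idl.subspace {x. \<phi> x \<in> idl.span (\<phi> ` S)}"
    by (rule idl.subspaceI) (auto simp: zero add mult idl.span_zero idl.span_add idl.span_scale)
  then have "idl.span S \<subseteq> {x. \<phi> x \<in> idl.span (\<phi> ` S)}"
    by (rule idl.span_minimal[rotated]) (auto intro: idl.span_base)
  then show "\<phi> ` idl.span S \<subseteq> idl.span (\<phi> ` S)" by blast
  have "idl.subspace (\<phi> ` idl.span S)"
  proof (rule idl.subspaceI)
    show "0 \<in> \<phi> ` idl.span S" using zero idl.span_zero by (metis imageI)
    show "x + y \<in> \<phi> ` idl.span S" if "x \<in> \<phi> ` idl.span S" "y \<in> \<phi> ` idl.span S" for x y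
      using that by (auto simp: idl.span_add simp flip: add)
    show "c * x \<in> \<phi> ` idl.span S" if "x \<in> \<phi> ` idl.span S" for c x
    proof -
      obtain d where "c = \<phi> d" using surj by (metis surjD)
      then show ?thesis using that by (auto simp: idl.span_scale simp flip: mult)
    qed
  qed
  then show "idl.span (\<phi> ` S) \<subseteq> \<phi> ` idl.span S"
    by (rule idl.span_minimal[rotated]) (auto intro: idl.span_base)
qed

lemma coords_bij:
  assumes "coords \<sigma>"
  shows "bij (subst \<sigma>)"
proof -
  obtain \<tau> where "\<And>v. subst \<sigma> (\<tau> v) = var v" "\<And>v. subst \<tau> (\<sigma> v) = var v"
    using assms by (auto simp: coords_def)
  then have "subst \<sigma> (subst \<tau> f) = f" "subst \<tau> (subst \<sigma> f) = f" for f
    by (simp_all add: subst_inverse)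
  then show ?thesis by (metis bijI')
qed

lemma coords_image_span:
  assumes "coords \<sigma>"
  shows "subst \<sigma> ` idl.span (var ` V) = idl.span (\<sigma> ` V)"
proof -
  have "subst \<sigma> ` idl.span (var ` V) = idl.span (subst \<sigma> ` var ` V)"
    by (rule surj_hom_image_span) (simp_all add: subst_simps bij_is_surj[OF coords_bij[OF assms]])
  then show ?thesis by (simp add: image_image subst_simps)
qed

lemma coords_nzd_mon_ideal:
  assumes "coords \<sigma>" "v \<notin> W"
  shows "nzd (subst \<sigma> ` mon_ideal W k) (\<sigma> v)"
  unfolding nzd_def
proof (intro allI impI)
  fix g assume *: "\<sigma> v * g \<in> subst \<sigma> ` mon_ideal W k"
  obtain h where g: "g = subst \<sigma> h" using bij_is_surj[OF coords_bij[OF assms(1)]] by (metis surjD)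
  then have "subst \<sigma> (var v * h) \<in> subst \<sigma> ` mon_ideal W k" using * by (simp add: subst_simps)
  then have "var v * h \<in> mon_ideal W k"
    using bij_is_inj[OF coords_bij[OF assms(1)]] by (simp add: inj_image_mem_iff)
  then have "h \<in> mon_ideal W k" using nzdD[OF nzd_mon_ideal[OF assms(2)]] by blast
  then show "g \<in> subst \<sigma> ` mon_ideal W k" unfolding g by (rule imageI)
qed

lemma coords_nzd_span:
  assumes "coords \<sigma>" "v \<notin> V"
  shows "nzd (idl.span (\<sigma> ` V)) (\<sigma> v)"
  using coords_nzd_mon_ideal[OF assms, of "Suc 0"] coords_image_span[OF assms(1)]
  by (simp add: mon_ideal_1)

section \<open>Powers of ideals under changes of coordinates\<close>

lemma ideal_prod_image:
  fixes \<phi> :: "'a::comm_ring_1 \<Rightarrow> 'b::comm_ring_1"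
  assumes add: "\<And>x y. \<phi> (x + y) = \<phi> x + \<phi> y" and mult: "\<And>x y. \<phi> (x * y) = \<phi> x * \<phi> y"
  shows "ideal_prod ring_of_type_algebra (\<phi> ` I) (\<phi> ` J) = \<phi> ` ideal_prod ring_of_type_algebra I J"
proof (intro equalityI subsetI)
  let ?R = "ring_of_type_algebra :: 'a ring" and ?S = "ring_of_type_algebra :: 'b ring"
  fix x assume "x \<in> ideal_prod ?S (\<phi> ` I) (\<phi> ` J)"
  then show "x \<in> \<phi> ` ideal_prod ?R I J"
  proof induction
    case (prod i j)
    then obtain a b where "a \<in> I" "b \<in> J" "i = \<phi> a" "j = \<phi> b" by blast
    then show ?case
      using ideal_prod.prod[of a I b J ?R] by (auto simp: type_algebra_sel simp flip: mult)
  next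
    case (sum s1 s2)
    then obtain a b where "a \<in> ideal_prod ?R I J" "b \<in> ideal_prod ?R I J" "s1 = \<phi> a" "s2 = \<phi> b" by blast
    then show ?case
      using ideal_prod.sum[of a ?R I J b] by (auto simp: type_algebra_sel simp flip: add)
  qed
next
  let ?R = "ring_of_type_algebra :: 'a ring" and ?S = "ring_of_type_algebra :: 'b ring"
  fix x assume "x \<in> \<phi> ` ideal_prod ?R I J"
  then obtain a where "a \<in> ideal_prod ?R I J" and x: "x = \<phi> a" by blast
  then show "x \<in> ideal_prod ?S (\<phi> ` I) (\<phi> ` J)"
    unfolding x
  proof (induction a)
    case (prod i j)
    then show ?case
      using ideal_prod.prod[of "\<phi> i" "\<phi> ` I" "\<phi> j" "\<phi> ` J" ?S] by (simp add: type_algebra_sel mult)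
  next
    case (sum s1 s2)
    then show ?case
      using ideal_prod.sum[of "\<phi> s1" ?S "\<phi> ` I" "\<phi> ` J" "\<phi> s2"] by (simp add: type_algebra_sel add)
  qed
qed

lemma ideals_set_pow_0: "I [^]\<^bsub>ideals_set ring_of_type_algebra\<^esub> (0::nat) = UNIV"
  by (simp add: nat_pow_def ideals_set_def ring_of_type_algebra_def)

lemma ideals_set_pow_Suc:
  "I [^]\<^bsub>ideals_set R\<^esub> Suc k = ideal_prod R (I [^]\<^bsub>ideals_set R\<^esub> k) I"
  by (simp add: nat_pow_def ideals_set_def)

text \<open>An automorphism carries products of ideals to products, so the powers inherit the
  monomial description of \<open>mon_ideal\<close>. This is what gives access to the powers of a
  point ideal.\<close>

lemma coords_power:
  assumes "coords \<sigma>"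
  shows "idl.span (\<sigma> ` W) [^]\<^bsub>ideals_set ring_of_type_algebra\<^esub> k = subst \<sigma> ` mon_ideal W k"
proof (induction k)
  case 0
  then show ?case
    using bij_is_surj[OF coords_bij[OF assms]] unfolding ideals_set_pow_0 mon_ideal_0 by simp
next
  case (Suc k)
  have "idl.span (\<sigma> ` W) = subst \<sigma> ` mon_ideal W (Suc 0)"
    by (simp add: mon_ideal_1 coords_image_span[OF assms])
  then show ?case
    unfolding ideals_set_pow_Suc Suc
    by (simp only: ideal_prod_image subst_simps ideal_prod_mon_ideal)
qed

lemma coords_span_range:
  assumes "coords \<sigma>"
  shows "idl.span (range \<sigma>) = idl.span (range var)"
proof -
  obtain \<tau> where \<tau>: "range \<tau> \<subseteq> idl.span (range var)" "\<And>v. subst \<sigma> (\<tau> v) = var v"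
    using assms by (auto simp: coords_def)
  have "var v \<in> idl.span (range \<sigma>)" for v
  proof -
    have "subst \<sigma> (\<tau> v) \<in> subst \<sigma> ` idl.span (range var)" using \<tau>(1) by blast
    then show ?thesis using \<tau>(2) coords_image_span[OF assms, of UNIV] by simp
  qed
  then have "range var \<subseteq> idl.span (range \<sigma>)" by blast
  moreover have "range \<sigma> \<subseteq> idl.span (range var)" using assms by (simp add: coords_def)
  ultimately show ?thesis by (simp add: idl.span_eq)
qed

text \<open>The map \<open>b\<close> sorts the variables into blocks and \<open>\<beta>\<close>
  selects one. With \<open>b = isl\<close> the two blocks are the x-variables and the
  y-variables.\<close>

definition lin_form :: "('v::finite \<Rightarrow> 'b) \<Rightarrow> ('v \<Rightarrow> 'k::field) \<Rightarrow> 'b \<Rightarrow> ('v \<Rightarrow>\<^sub>0 nat) \<Rightarrow>\<^sub>0 'k"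
  where "lin_form b \<kappa> \<beta> = (\<Sum>v | b v = \<beta>. cst (\<kappa> v) * var v)"

text \<open>In each block one pivot variable is exchanged for the linear form, and every other
  variable is corrected by a multiple of the form so that it vanishes at \<open>p\<close>. The
  condition on \<open>p\<close> says that the form takes the value 1 there.\<close>

lemma block_coords:
  fixes b :: "'v::finite \<Rightarrow> 'b" and q :: "'b \<Rightarrow> 'v" and \<kappa> p :: "'v \<Rightarrow> 'k::field"
  assumes q: "\<And>v. b (q (b v)) = b v" and \<kappa>: "\<And>v. \<kappa> (q (b v)) \<noteq> 0"
    and p: "\<And>v. (\<Sum>w | b w = b v. \<kappa> w * p w) = 1"
  defines "\<sigma> \<equiv> \<lambda>v. if v = q (b v) then lin_form b \<kappa> (b v) else var v - cst (p v) * lin_form b \<kappa> (b v)"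
  shows "coords \<sigma>"
    and "var v - cst (p v) * lin_form b \<kappa> (b v) \<in> idl.span (\<sigma> ` {v. v \<noteq> q (b v)})"
proof -
  let ?l = "lin_form b \<kappa>"
  let ?B = "\<lambda>v. {w. b w = b v \<and> w \<noteq> q (b v)}"
  have split: "(\<Sum>w | b w = b v. f w) = f (q (b v)) + (\<Sum>w\<in>?B v. f w)" for v and f :: "'v \<Rightarrow> 'c::comm_monoid_add"
  proof -
    have "{w. b w = b v} = insert (q (b v)) (?B v)" using q by auto
    then show ?thesis by simp
  qed
  \<comment> \<open>Over a block, the corrected variables weighted by \<open>\<kappa>\<close> add up
    to l - l = 0. Hence the corrected pivot is a combination of the others, as its own weight is
    nonzero.\<close>
  have pivot: "var v - cst (p v) * ?l (b v) = - (\<Sum>w\<in>?B v. cst (\<kappa> w / \<kappa> v) * \<sigma> w)"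
    if v: "v = q (b v)" for v
  proof -
    have "(\<Sum>w | b w = b v. cst (\<kappa> w) * (var w - cst (p w) * L)) =
        (\<Sum>w | b w = b v. cst (\<kappa> w) * var w) - cst (\<Sum>w | b w = b v. \<kappa> w * p w) * L" for L
      by (simp only: right_diff_distrib sum_subtractf cst_sum cst_mult sum_distrib_right mult.assoc)
    then have "(\<Sum>w | b w = b v. cst (\<kappa> w) * (var w - cst (p w) * ?l (b v))) =
        ?l (b v) - cst (\<Sum>w | b w = b v. \<kappa> w * p w) * ?l (b v)"
      unfolding lin_form_def .
    also have "\<dots> = 0" unfolding p by simp
    finally have "cst (\<kappa> v) * (var v - cst (p v) * ?l (b v)) +
        (\<Sum>w\<in>?B v. cst (\<kappa> w) * (var w - cst (p w) * ?l (b v))) = 0"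
      using split[of "\<lambda>w. cst (\<kappa> w) * (var w - cst (p w) * ?l (b v))" v] v by metis
    also have "(\<Sum>w\<in>?B v. cst (\<kappa> w) * (var w - cst (p w) * ?l (b v))) = (\<Sum>w\<in>?B v. cst (\<kappa> w) * \<sigma> w)"
      by (intro sum.cong) (auto simp: \<sigma>_def)
    finally have *: "cst (\<kappa> v) * (var v - cst (p v) * ?l (b v)) = - (\<Sum>w\<in>?B v. cst (\<kappa> w) * \<sigma> w)"
      by (simp add: eq_neg_iff_add_eq_0)
    have "\<kappa> v \<noteq> 0" using \<kappa>[of v] v by simp
    then have "cst (1 / \<kappa> v) * cst (\<kappa> v) = (1 :: ('v \<Rightarrow>\<^sub>0 nat) \<Rightarrow>\<^sub>0 'k)" by (simp flip: cst_mult)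
    then have "var v - cst (p v) * ?l (b v) = cst (1 / \<kappa> v) * (cst (\<kappa> v) * (var v - cst (p v) * ?l (b v)))"
      by (simp only: mult.assoc[symmetric] mult_1_left)
    also have "\<dots> = - (\<Sum>w\<in>?B v. cst (\<kappa> w / \<kappa> v) * \<sigma> w)"
      unfolding * by (simp add: sum_distrib_left mult.assoc[symmetric] flip: cst_mult)
    finally show ?thesis .
  qed
  show "var v - cst (p v) * ?l (b v) \<in> idl.span (\<sigma> ` {v. v \<noteq> q (b v)})"
  proof (cases "v = q (b v)")
    case True
    show ?thesis
      unfolding pivot[OF True]
      by (intro idl.span_neg idl.span_sum idl.span_scale idl.span_base) auto
  next
    case False
    then have "var v - cst (p v) * ?l (b v) = \<sigma> v" by (simp add: \<sigma>_def)
    then show ?thesis using False by (simp add: idl.span_base)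
  qed
  \<comment> \<open>The inverse is found by solving for the old variables: a nonpivot variable is
    its corrected version plus \<open>p v\<close> times the form, and the pivot is given by the
    relation \<open>pivot\<close>. The pivot position now stands for the form.\<close>
  define \<tau> where "\<tau> v = (if v = q (b v) then cst (p v) * var v - (\<Sum>w\<in>?B v. cst (\<kappa> w / \<kappa> v) * var w)
    else var v + cst (p v) * var (q (b v)))" for v
  have l_span: "?l \<beta> \<in> idl.span (range var)" for \<beta>
    unfolding lin_form_def by (intro idl.span_sum idl.span_scale idl.span_base) auto
  have qq: "q (b (q (b v))) = q (b v)" for v by (simp add: q)
  have "subst \<sigma> (\<tau> v) = var v" for v
  proof (cases "v = q (b v)")
    case True
    then have "subst \<sigma> (\<tau> v) = cst (p v) * ?l (b v) - (\<Sum>w\<in>?B v. cst (\<kappa> w / \<kappa> v) * \<sigma> w)"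
      by (simp add: \<tau>_def subst_simps \<sigma>_def)
    also have "\<dots> = var v" using pivot[OF True] by (simp add: algebra_simps)
    finally show ?thesis .
  next
    case False
    then show ?thesis by (simp add: \<tau>_def subst_simps \<sigma>_def q)
  qed
  moreover have "subst \<tau> (\<sigma> v) = var v" for v
  proof -
    let ?q = "q (b v)"
    have cancel: "x - y + (y + z) = x + z" for x y z :: "('v \<Rightarrow>\<^sub>0 nat) \<Rightarrow>\<^sub>0 'k" by simp
    \<comment> \<open>The contributions of the nonpivot variables cancel, and the coefficient left
      on the pivot variable is the sum that equals 1 by the normalisation of
      \<open>p\<close>.\<close>
    have "subst \<tau> (?l (b v)) = cst (\<kappa> ?q) * \<tau> ?q + (\<Sum>w\<in>?B v. cst (\<kappa> w) * \<tau> w)"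
      unfolding lin_form_def by (simp add: subst_simps split)
    also have "cst (\<kappa> ?q) * \<tau> ?q = cst (\<kappa> ?q * p ?q) * var ?q - (\<Sum>w\<in>?B v. cst (\<kappa> w) * var w)"
    proof -
      have \<tau>q: "\<tau> ?q = cst (p ?q) * var ?q - (\<Sum>w\<in>?B v. cst (\<kappa> w / \<kappa> ?q) * var w)"
        by (simp add: \<tau>_def qq q)
      have "cst (\<kappa> ?q) * \<tau> ?q =
          cst (\<kappa> ?q * p ?q) * var ?q - (\<Sum>w\<in>?B v. cst (\<kappa> ?q) * cst (\<kappa> w / \<kappa> ?q) * var w)"
        by (simp only: \<tau>q right_diff_distrib cst_mult sum_distrib_left mult.assoc)
      then show ?thesis using \<kappa>[of v] by (simp flip: cst_mult)
    qed
    also have "(\<Sum>w\<in>?B v. cst (\<kappa> w) * \<tau> w) =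
        (\<Sum>w\<in>?B v. cst (\<kappa> w) * var w) + cst (\<Sum>w\<in>?B v. \<kappa> w * p w) * var ?q"
    proof -
      have "(\<Sum>w\<in>?B v. cst (\<kappa> w) * \<tau> w) =
          (\<Sum>w\<in>?B v. cst (\<kappa> w) * var w + cst (\<kappa> w * p w) * var ?q)"
      proof (rule sum.cong)
        fix w assume "w \<in> ?B v"
        then have "\<tau> w = var w + cst (p w) * var ?q" by (auto simp: \<tau>_def)
        then show "cst (\<kappa> w) * \<tau> w = cst (\<kappa> w) * var w + cst (\<kappa> w * p w) * var ?q"
          by (simp only: distrib_left cst_mult mult.assoc)
      qed simp
      then show ?thesis by (simp only: sum.distrib cst_sum sum_distrib_right)
    qed
    finally have "subst \<tau> (?l (b v)) = cst (\<Sum>w | b w = b v. \<kappa> w * p w) * var ?q"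
      by (simp only: split cst_add distrib_right cancel)
    then have l: "subst \<tau> (?l (b v)) = var ?q" by (simp add: p)
    show ?thesis
    proof (cases "v = ?q")
      case True
      then show ?thesis using l by (simp add: \<sigma>_def)
    next
      case False
      then show ?thesis by (simp add: \<sigma>_def subst_simps l) (simp add: \<tau>_def)
    qed
  qed
  moreover have "range \<sigma> \<subseteq> idl.span (range var)"
    using l_span by (auto simp: \<sigma>_def intro: idl.span_diff idl.span_scale idl.span_base)
  moreover have "range \<tau> \<subseteq> idl.span (range var)"
  proof (intro image_subsetI)
    fix v
    have "var w \<in> idl.span (range var)" for w :: 'v by (intro idl.span_base rangeI)
    then show "\<tau> v \<in> idl.span (range var)"
      by (auto simp: \<tau>_def intro!: idl.span_diff idl.span_add idl.span_scale idl.span_sum)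
  qed
  ultimately show "coords \<sigma>" unfolding coords_def by blast
qed

section \<open>Points and their ideals\<close>

lemma prod_UNIV_sum_type:
  fixes g :: "'n::finite + 'm::finite \<Rightarrow> 'a::comm_monoid_mult"
  shows "(\<Prod>v\<in>UNIV. g v) = (\<Prod>i\<in>UNIV. g (Inl i)) * (\<Prod>j\<in>UNIV. g (Inr j))"
  using prod.Plus[of "UNIV :: 'n set" "UNIV :: 'm set" g] by simp

lemma eval_at_eq_ins: "eval_at f a b = ins (\<lambda>x. x) (case_sum a b) f"
  by (simp only: eval_at_def ins_def mult.assoc prod_UNIV_sum_type sum.case)

lemma irrelevant_ideal_eq: "irrelevant_ideal = idl.span (range var)"
  by (simp add: irrelevant_ideal_def genideal_type_algebra variable_eq_var)

lemma proj_spaceE: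
  assumes "A \<in> proj_space"
  obtains a where "a \<noteq> (\<lambda>_. 0)" "A = {\<lambda>i. c * a i |c. c \<noteq> 0}"
  using assms unfolding proj_space_def by (auto elim!: quotientE)

lemma biproj_spaceE:
  assumes "P \<in> biproj_space"
  obtains a b where "a \<noteq> (\<lambda>_. 0)" "b \<noteq> (\<lambda>_. 0)"
    "fst P = {\<lambda>i. c * a i |c. c \<noteq> 0}" "snd P = {\<lambda>i. c * b i |c. c \<noteq> 0}"
proof -
  have "fst P \<in> proj_space" "snd P \<in> proj_space" using assms by (auto simp: biproj_space_def)
  then show ?thesis using that by (elim proj_spaceE) blast
qed

text \<open>A single \<open>\<kappa>\<close> holds the coefficients of both forms l_1 (block
  \<open>True\<close>) and l_2 (block \<open>False\<close>).\<close>

definition avoids :: "('n::finite + 'm::finite \<Rightarrow> 'k::field) \<Rightarrow> ('k, 'n, 'm) bipoint \<Rightarrow> bool"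
  where "avoids \<kappa> P \<longleftrightarrow>
    (\<forall>a\<in>fst P. \<forall>b\<in>snd P. \<forall>\<beta>. (\<Sum>v | isl v = \<beta>. \<kappa> v * case_sum a b v) \<noteq> 0)"

text \<open>By bihomogeneity each monomial contributes the same powers of the two factors
  \<open>l\<close>, leaving the value of \<open>f\<close> at \<open>p\<close>. So a form vanishing
  at the point vanishes under this substitution.\<close>

lemma subst_scaled_form:
  fixes f :: "('k::field, 'n::finite, 'm::finite) bipoly"
  assumes "f \<in> forms d"
  shows "subst (\<lambda>v. cst (p v) * l (isl v)) f = cst (ins (\<lambda>x. x) p f) * (l True ^ fst d * l False ^ snd d)"
proof -
  have mon: "cst c * (\<Prod>v\<in>UNIV. (cst (p v) * l (isl v)) ^ Poly_Mapping.lookup t v) =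
      cst (c * (\<Prod>v\<in>UNIV. p v ^ Poly_Mapping.lookup t v)) * (l True ^ fst d * l False ^ snd d)"
    if "monom_deg t = d" for t c
  proof -
    have "(\<Prod>v\<in>UNIV. l (isl v) ^ Poly_Mapping.lookup t v) = l True ^ fst d * l False ^ snd d"
      using that by (auto simp: prod_UNIV_sum_type monom_deg_def power_sum)
    then show ?thesis
      by (simp only: power_mult_distrib prod.distrib cst_mult cst_prod cst_power mult.assoc)
  qed
  have "subst (\<lambda>v. cst (p v) * l (isl v)) f = (\<Sum>t\<in>Poly_Mapping.keys f.
      cst (Poly_Mapping.lookup f t * (\<Prod>v\<in>UNIV. p v ^ Poly_Mapping.lookup t v)) * (l True ^ fst d * l False ^ snd d))"
    unfolding ins_def by (intro sum.cong mon) (use assms in \<open>auto simp: forms_def\<close>)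
  then show ?thesis by (simp only: ins_def cst_sum sum_distrib_right)
qed

lemma lin_form_in_forms: "lin_form isl \<kappa> \<beta> \<in> forms (if \<beta> then (1, 0) else (0, 1))"
  unfolding lin_form_def
proof (rule forms_sum)
  fix v :: "'a + 'b" assume "v \<in> {v. isl v = \<beta>}"
  then show "cst (\<kappa> v) * var v \<in> forms (if \<beta> then (1, 0) else (0, 1))"
    using forms_cst_mult[OF var_in_forms, of "\<kappa> v" v] by (simp add: var_deg_def)
qed

lemma lin_form_in_irrelevant: "lin_form b \<kappa> \<beta> \<in> idl.span (range var)"
  unfolding lin_form_def by (intro idl.span_sum idl.span_scale idl.span_base) auto

lemma ins_lin_form: "ins (\<lambda>x. x) p (lin_form b \<kappa> \<beta>) = (\<Sum>v | b v = \<beta>. \<kappa> v * p v)"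
  by (simp add: lin_form_def ins_id_simps)

text \<open>
  Normalising the coordinates of \<open>P\<close> so that both linear forms take the value 1, the differences
  between the variables and the multiples of these forms by the coordinates of \<open>P\<close> cut out \<open>P\<close>.
\<close>

lemma point_coords:
  fixes P :: "('k::field, 'n::finite, 'm::finite) bipoint"
  assumes P: "P \<in> biproj_space" and \<kappa>: "avoids \<kappa> P"
  obtains \<sigma> q p where "coords \<sigma>" "\<And>\<beta>. isl (q \<beta>) = \<beta>" "\<And>\<beta>. \<sigma> (q \<beta>) = lin_form isl \<kappa> \<beta>"
    "\<And>v. \<sigma> v \<in> forms (var_deg v)"
    "point_ideal P = idl.span (\<sigma> ` {v. v \<noteq> q (isl v)})"
    "\<And>v. var v - cst (p v) * lin_form isl \<kappa> (isl v) \<in> point_ideal P"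
proof -
  obtain a b where a: "fst P = {\<lambda>i. c * a i |c. c \<noteq> 0}" and b: "snd P = {\<lambda>i. c * b i |c. c \<noteq> 0}"
    by (rule biproj_spaceE[OF P])
  have in_P: "(\<lambda>i. c * a i) \<in> fst P" "(\<lambda>i. c * b i) \<in> snd P" if "c \<noteq> 0" for c
    using that unfolding a b by blast+
  define N where "N \<beta> = (\<Sum>v | isl v = \<beta>. \<kappa> v * case_sum a b v)" for \<beta>
  have N: "N \<beta> \<noteq> 0" for \<beta>
    using \<kappa> in_P[of 1] unfolding avoids_def N_def by simp
  have "\<exists>w. isl w = \<beta> \<and> \<kappa> w \<noteq> 0" for \<beta>
  proof (rule ccontr)
    assume "\<not> ?thesis"
    then have "N \<beta> = 0" unfolding N_def by (intro sum.neutral) auto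
    then show False using N by blast
  qed
  then obtain q where q: "isl (q \<beta>) = \<beta>" "\<kappa> (q \<beta>) \<noteq> 0" for \<beta> by metis
  define p where "p v = case_sum a b v / N (isl v)" for v
  define \<sigma> where "\<sigma> v = (if v = q (isl v) then lin_form isl \<kappa> (isl v)
    else var v - cst (p v) * lin_form isl \<kappa> (isl v))" for v
  have p1: "(\<Sum>w | isl w = isl v. \<kappa> w * p w) = 1" for v
  proof -
    have "(\<Sum>w | isl w = isl v. \<kappa> w * p w) = (\<Sum>w | isl w = isl v. \<kappa> w * case_sum a b w / N (isl v))"
      by (intro sum.cong) (auto simp: p_def)
    also have "\<dots> = N (isl v) / N (isl v)" unfolding N_def by (simp only: sum_divide_distrib)
    finally show ?thesis using N by simp
  qed
  let ?J = "idl.span (\<sigma> ` {v. v \<noteq> q (isl v)})"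
  have coords: "coords \<sigma>"
    unfolding \<sigma>_def by (rule block_coords(1)) (simp_all add: q p1)
  have diff: "var v - cst (p v) * lin_form isl \<kappa> (isl v) \<in> ?J" for v
    unfolding \<sigma>_def by (rule block_coords(2)) (simp_all add: q p1)
  have form: "\<sigma> v \<in> forms (var_deg v)" for v
  proof -
    have l: "lin_form isl \<kappa> (isl v) \<in> forms (var_deg v)"
      using lin_form_in_forms[of \<kappa> "isl v"] by (simp add: var_deg_def)
    show ?thesis unfolding \<sigma>_def using l by (auto intro: forms_diff var_in_forms forms_cst_mult)
  qed
  have "point_ideal P = ?J"
  proof (intro equalityI)
    show "point_ideal P \<subseteq> ?J"
      unfolding point_ideal_def genideal_type_algebra
    proof (rule idl.span_minimal, safe)
      fix f d
      assume f: "f \<in> forms d" and van: "\<forall>a\<in>fst P. \<forall>b\<in>snd P. eval_at f a b = 0"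
      have "case_sum (\<lambda>i. 1 / N True * a i) (\<lambda>i. 1 / N False * b i) = p"
        by (auto simp: p_def fun_eq_iff split: sum.split)
      moreover have "eval_at f (\<lambda>i. 1 / N True * a i) (\<lambda>i. 1 / N False * b i) = 0"
        using van in_P N by (metis divide_eq_0_iff zero_neq_one)
      ultimately have "ins (\<lambda>x. x) p f = 0" by (simp add: eval_at_eq_ins)
      \<comment> \<open>Modulo \<open>?J\<close> every variable equals its coordinate times the form
        of its block. Thus \<open>f\<close> is congruent to its value at \<open>p\<close> times
        powers of the forms, which is zero.\<close>
      then have "subst (\<lambda>v. cst (p v) * lin_form isl \<kappa> (isl v)) f = 0"
        by (simp add: subst_scaled_form[OF f])
      moreover have "subst var f - subst (\<lambda>v. cst (p v) * lin_form isl \<kappa> (isl v)) f \<in> ?J"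
        by (rule subst_cong_mod) (simp_all add: diff)
      ultimately show "f \<in> ?J" by (simp add: subst_var)
    qed
    show "?J \<subseteq> point_ideal P"
      unfolding point_ideal_def genideal_type_algebra
    proof (rule idl.span_mono, safe)
      fix v assume v: "v \<noteq> q (isl v)"
      show "\<exists>d. \<sigma> v \<in> forms d" using form by blast
      fix a' b' assume "a' \<in> fst P" "b' \<in> snd P"
      then obtain c d where a': "a' = (\<lambda>i. c * a i)" and b': "b' = (\<lambda>i. d * b i)"
        unfolding a b by blast
      \<comment> \<open>The two factors of the product of projective spaces are rescaled
        independently; only the scalar belonging to the block of \<open>v\<close> enters.\<close>
      let ?C = "if isl v then c else d"
      have cs: "case_sum a' b' w = ?C * case_sum a b w" if "isl w = isl v" for w
        using that by (cases w) (auto simp: a' b')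
      have "(\<Sum>w | isl w = isl v. \<kappa> w * case_sum a' b' w) = (\<Sum>w | isl w = isl v. ?C * (\<kappa> w * case_sum a b w))"
        by (intro sum.cong refl) (simp add: cs)
      also have "\<dots> = ?C * N (isl v)" by (simp add: N_def sum_distrib_left)
      finally have "ins (\<lambda>x. x) (case_sum a' b') (\<sigma> v) = case_sum a' b' v - p v * (?C * N (isl v))"
        using v by (simp add: \<sigma>_def ins_id_simps ins_lin_form)
      also have "\<dots> = 0" using N[of "isl v"] by (simp add: cs p_def)
      finally show "eval_at (\<sigma> v) a' b' = 0" by (simp add: eval_at_eq_ins)
    qed
  qed
  then show ?thesis
    using that[of \<sigma> q p] coords form diff q(1) by (simp add: \<sigma>_def q(1))
qed

text \<open>The two linear forms are exactly the coordinates missing from the generators of the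
  point ideal. They are therefore nonzerodivisors modulo each of its powers.\<close>

lemma point_power:
  fixes P :: "('k::field, 'n::finite, 'm::finite) bipoint" and k :: nat
  assumes P: "P \<in> biproj_space" and \<kappa>: "avoids \<kappa> P"
  shows "idl.subspace (point_ideal P [^]\<^bsub>ideals_set coord_ring\<^esub> k)" (is "?sub k")
    and "homogeneous (point_ideal P [^]\<^bsub>ideals_set coord_ring\<^esub> k)" (is "?hom k")
    and "nzd (point_ideal P [^]\<^bsub>ideals_set coord_ring\<^esub> k) (lin_form isl \<kappa> \<beta>)"
proof -
  obtain \<sigma> q p where \<sigma>: "coords \<sigma>" "\<And>\<beta>. isl (q \<beta>) = \<beta>" "\<And>\<beta>. \<sigma> (q \<beta>) = lin_form isl \<kappa> \<beta>"
    "\<And>v. \<sigma> v \<in> forms (var_deg v)" and J: "point_ideal P = idl.span (\<sigma> ` {v. v \<noteq> q (isl v)})"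
    and "\<And>v. var v - cst (p v) * lin_form isl \<kappa> (isl v) \<in> point_ideal P"
    by (rule point_coords[OF assms], rule that)
  show "nzd (point_ideal P [^]\<^bsub>ideals_set coord_ring\<^esub> k) (lin_form isl \<kappa> \<beta>)"
    unfolding J coords_power[OF \<sigma>(1)] \<sigma>(3)[symmetric]
    by (rule coords_nzd_mon_ideal[OF \<sigma>(1)]) (simp add: \<sigma>(2))
  have hom1: "homogeneous (point_ideal P)"
    unfolding J by (rule homogeneous_span) (use \<sigma>(4) in auto)
  have "?sub k \<and> ?hom k"
  proof (induction k)
    case 0
    show ?case unfolding ideals_set_pow_0 by (simp add: homogeneous_def)
  next
    case (Suc k)
    have sub1: "idl.subspace (point_ideal P)" by (simp add: J)
    show ?case
      unfolding ideals_set_pow_Suc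
      using homogeneous_ideal_prod[OF _ hom1 _ sub1] subspace_ideal_prod[OF _ sub1] Suc by blast
  qed
  then show "?sub k" "?hom k" by auto
qed

lemma power_in_ideal_power:
  fixes a :: "'a::comm_ring_1"
  assumes "a \<in> I"
  shows "a ^ k \<in> I [^]\<^bsub>ideals_set ring_of_type_algebra\<^esub> k"
proof (induction k)
  case (Suc k)
  then show ?case
    unfolding ideals_set_pow_Suc
    using ideal_prod.prod[OF Suc assms, of ring_of_type_algebra] by (simp add: type_algebra_sel mult.commute)
next
  case 0
  show ?case unfolding ideals_set_pow_0 by simp
qed

section \<open>Ideals of fat points\<close>

context
  fixes P :: "nat \<Rightarrow> ('k::field, 'n::finite, 'm::finite) bipoint" and s :: nat
    and \<kappa> :: "'n + 'm \<Rightarrow> 'k"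
  assumes P: "\<And>j. j \<in> {1..s} \<Longrightarrow> P j \<in> biproj_space"
    and \<kappa>: "\<And>j. j \<in> {1..s} \<Longrightarrow> avoids \<kappa> (P j)"
begin

lemma fat_ideal_subspace: "idl.subspace (fat_ideal s P \<mu>)"
  unfolding fat_ideal_def by (intro idl.subspace_Int) (use point_power(1)[OF P \<kappa>] in blast)

lemma fat_ideal_homogeneous: "homogeneous (fat_ideal s P \<mu>)"
  unfolding fat_ideal_def homogeneous_def
  by (auto intro: homogeneousD[OF point_power(2)[OF P \<kappa>]])

lemma fat_ideal_nzd: "nzd (fat_ideal s P \<mu>) (lin_form isl \<kappa> \<beta>)"
  unfolding fat_ideal_def nzd_def
  by (auto intro: nzdD[OF point_power(3)[OF P \<kappa>]])

text \<open>At each point the variable agrees with a multiple of the form modulo the point ideal.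
  The product of the differences, with the multiplicities as exponents, lies in the fat ideal and is
  a pure power of the variable modulo the form.\<close>

lemma var_power_in_fat_ideal:
  obtains r where "var v ^ r \<in> idl.span (insert (lin_form isl \<kappa> (isl v)) (fat_ideal s P \<mu>))"
proof -
  let ?l = "lin_form isl \<kappa> (isl v)"
  have "\<exists>c. var v - c * ?l \<in> point_ideal (P j)" if "j \<in> {1..s}" for j
    by (rule point_coords[OF P[OF that] \<kappa>[OF that]]) blast
  then obtain c where c: "var v - c j * ?l \<in> point_ideal (P j)" if "j \<in> {1..s}" for j by metis
  let ?g = "\<Prod>j\<in>{1..s}. (var v - c j * ?l) ^ \<mu> j"
  have "?g \<in> point_ideal (P j) [^]\<^bsub>ideals_set coord_ring\<^esub> \<mu> j" if j: "j \<in> {1..s}" for j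
  proof -
    have "?g = (\<Prod>j\<in>{1..s} - {j}. (var v - c j * ?l) ^ \<mu> j) * (var v - c j * ?l) ^ \<mu> j"
      using j by (simp add: prod.remove mult.commute)
    then show ?thesis
      using idl.subspace_scale[OF point_power(1)[OF P[OF j] \<kappa>[OF j]] power_in_ideal_power[OF c[OF j]]]
      by simp
  qed
  then have "?g \<in> fat_ideal s P \<mu>" by (simp add: fat_ideal_def)
  moreover have "(\<Prod>j\<in>{1..s}. var v ^ \<mu> j) - ?g \<in> idl.span {?l}"
    by (intro idl_cong_prod idl_cong_power) (auto intro: idl.span_scale idl.span_base)
  moreover have "idl.span {?l} \<subseteq> idl.span (insert ?l (fat_ideal s P \<mu>))" by (rule idl.span_mono) auto
  ultimately have "((\<Prod>j\<in>{1..s}. var v ^ \<mu> j) - ?g) + ?g \<in> idl.span (insert ?l (fat_ideal s P \<mu>))"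
    by (intro idl.span_add) (auto intro: idl.span_base)
  then have "var v ^ sum \<mu> {1..s} \<in> idl.span (insert ?l (fat_ideal s P \<mu>))" by (simp add: power_sum)
  then show ?thesis by (rule that)
qed

end

section \<open>Regularity of the chosen linear forms from depth 2\<close>

text \<open>By induction on the total exponent: multiplying \<open>g\<close> by a variable lowers
  one exponent, so all products with variables lie in \<open>J\<close>, and \<open>socle\<close>
  then applies to \<open>g\<close> itself.\<close>

lemma irrelevant_torsion_by_powers:
  fixes J :: "(('v::finite \<Rightarrow>\<^sub>0 nat) \<Rightarrow>\<^sub>0 'k::field) set"
  assumes J: "idl.subspace J"
    and socle: "\<And>g. (\<And>u. u \<in> idl.span (range var) \<Longrightarrow> u * g \<in> J) \<Longrightarrow> g \<in> J"
    and "\<And>v. var v ^ e v * g \<in> J"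
  shows "g \<in> J"
  using assms(3)
proof (induction "\<Sum>v\<in>UNIV. e v" arbitrary: e g rule: less_induct)
  case less
  show ?case
  proof (rule socle)
    have var: "var v * g \<in> J" for v
    proof (cases "e v")
      case 0
      then show ?thesis using less.prems[of v] idl.subspace_scale[OF J] by simp
    next
      case (Suc k)
      have "sum (e(v := k)) UNIV < sum e UNIV"
        using Suc by (intro sum_strict_mono_ex1) auto
      moreover have "var w ^ (e(v := k)) w * (var v * g) \<in> J" for w
      proof (cases "w = v")
        case True
        then show ?thesis using less.prems[of v] Suc by (simp add: mult_ac)
      next
        case False
        then show ?thesis
          using idl.subspace_scale[OF J less.prems[of w], of "var v"] by (simp add: mult_ac)
      qed
      ultimately show ?thesis by (rule less.hyps)
    qed
    have "idl.subspace {u. u * g \<in> J}"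
      by (rule idl.subspaceI)
         (simp_all add: idl.subspace_0[OF J] distrib_right idl.subspace_add[OF J] mult.assoc idl.subspace_scale[OF J])
    then have "idl.span (range var) \<subseteq> {u. u * g \<in> J}"
      by (rule idl.span_minimal[rotated]) (use var in auto)
    then show "u * g \<in> J" if "u \<in> idl.span (range var)" for u using that by blast
  qed
qed

text \<open>An exchange argument, since the regular sequence supplied by depth need not start with
  \<open>l\<close>. Writing f1 g = l h modulo \<open>I\<close> trades \<open>g\<close> for
  \<open>h\<close>, which \<open>M\<close> kills modulo f1. As f2 lies in \<open>M\<close> and is
  regular there, h = f1 h' modulo \<open>I\<close>, and cancelling f1 gives g = l h'.\<close>

lemma nzd_socle:
  fixes I :: "'a::comm_ring_1 set"
  assumes I: "idl.subspace I" and f: "f1 \<in> M" "f2 \<in> M" "nzd I f1" "nzd (idl.span (insert f1 I)) f2"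
    and l: "nzd I l" and g: "\<And>u. u \<in> M \<Longrightarrow> u * g \<in> idl.span (insert l I)"
  shows "g \<in> idl.span (insert l I)"
proof -
  note adj = idl_span_insert_subspace_iff[OF I]
  obtain h where h: "f1 * g - l * h \<in> I" using g[OF f(1)] adj by blast
  have "u * h \<in> idl.span (insert f1 I)" if u: "u \<in> M" for u
  proof -
    obtain h' where h': "u * g - l * h' \<in> I" using g[OF u] adj by blast
    have "l * (u * h - f1 * h') = f1 * (u * g - l * h') - u * (f1 * g - l * h)"
      by (simp add: algebra_simps)
    also have "\<dots> \<in> I" by (intro idl.subspace_diff[OF I] idl.subspace_scale[OF I] h h')
    finally have "u * h - f1 * h' \<in> I" by (rule nzdD[OF l])
    then show ?thesis using adj by blast
  qed
  then have "h \<in> idl.span (insert f1 I)" using f nzdD by blast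
  then obtain h' where h': "h - f1 * h' \<in> I" using adj by blast
  have "f1 * (g - l * h') = (f1 * g - l * h) + l * (h - f1 * h')" by (simp add: algebra_simps)
  also have "\<dots> \<in> I" by (intro idl.subspace_add[OF I] idl.subspace_scale[OF I] h h')
  finally have "g - l * h' \<in> I" by (rule nzdD[OF f(3)])
  then show ?thesis using adj by blast
qed

lemma fat_ideal_regular:
  fixes P :: "nat \<Rightarrow> ('k::field, 'n::finite, 'm::finite) bipoint"
  assumes P: "\<And>j. j \<in> {1..s} \<Longrightarrow> P j \<in> biproj_space"
    and \<kappa>: "\<And>j. j \<in> {1..s} \<Longrightarrow> avoids \<kappa> (P j)"
    and depth: "depth_quot (fat_ideal s P \<mu>) = 2"
  shows "nzd (idl.span (insert (lin_form isl \<kappa> True) (fat_ideal s P \<mu>))) (lin_form isl \<kappa> False)"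
proof -
  let ?I = "fat_ideal s P \<mu>" and ?l = "lin_form isl \<kappa>"
  let ?J = "idl.span (insert (?l True) ?I)"
  have I: "idl.subspace ?I" by (rule fat_ideal_subspace[OF P \<kappa>])
  obtain f1 f2 where f: "f1 \<in> irrelevant_ideal" "f2 \<in> irrelevant_ideal" "nzd ?I f1" "nzd (idl.span (insert f1 ?I)) f2"
    using depth_2_regular[OF depth I] by metis
  show ?thesis
    unfolding nzd_def
  proof (intro allI impI)
    fix g assume g: "?l False * g \<in> ?J"
    \<comment> \<open>A power of each x-variable already lies in \<open>?J\<close>. For a y-variable
      some power is a multiple of l_2 modulo the fat ideal, and l_2 sends \<open>g\<close> into
      \<open>?J\<close>.\<close>
    have "\<exists>r. var v ^ r * g \<in> ?J" for v
    proof -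
      obtain r where r: "var v ^ r \<in> idl.span (insert (?l (isl v)) ?I)"
        by (rule var_power_in_fat_ideal[OF P \<kappa>])
      show ?thesis
      proof (cases "isl v")
        case True
        then have "g * var v ^ r \<in> ?J" using r by (intro idl.span_scale) simp
        then show ?thesis by (auto simp: mult.commute)
      next
        case False
        then obtain c b where "c \<in> ?I" "var v ^ r = c + ?l False * b"
          using r unfolding idl_span_insert_iff iffD2[OF idl.span_eq_iff I] by auto
        then have "var v ^ r * g = g * c + b * (?l False * g)" by (simp add: algebra_simps)
        also have "\<dots> \<in> ?J" using \<open>c \<in> ?I\<close>
          by (intro idl.span_add idl.span_scale[OF g] idl.span_scale[OF idl.span_base]) auto
        finally show ?thesis by blast
      qed
    qed
    then obtain e where "var v ^ e v * g \<in> ?J" for v by metis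
    then show "g \<in> ?J"
    proof (rule irrelevant_torsion_by_powers[rotated 2])
      fix g assume *: "\<And>u. u \<in> idl.span (range var) \<Longrightarrow> u * g \<in> ?J"
      show "g \<in> ?J"
        by (rule nzd_socle[OF I f(1,2)[unfolded irrelevant_ideal_eq] f(3,4) fat_ideal_nzd[OF P \<kappa>] *])
    qed (rule idl.subspace_span)
  qed
qed

section \<open>Linear forms missing finitely many points\<close>

text \<open>Adding \<open>t\<close> to one coefficient where the new vector is nonzero spoils a
  given vector for at most one value of \<open>t\<close>, and a field of characteristic zero is
  infinite.\<close>

lemma exists_common_nonzero:
  fixes A :: "('v::finite \<Rightarrow> 'k::field_char_0) set"
  assumes "finite A" "\<And>a. a \<in> A \<Longrightarrow> a \<noteq> (\<lambda>_. 0)"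
  shows "\<exists>\<kappa>. \<forall>a\<in>A. (\<Sum>v\<in>UNIV. \<kappa> v * a v) \<noteq> 0"
  using assms
proof (induction A)
  case (insert b A)
  then obtain \<kappa> where \<kappa>: "\<And>a. a \<in> A \<Longrightarrow> (\<Sum>v\<in>UNIV. \<kappa> v * a v) \<noteq> 0" by auto
  obtain i where i: "b i \<noteq> 0" using insert.prems[of b] by auto
  \<comment> \<open>For vectors with \<open>a i = 0\<close> the quotient is the default 0. This only
    excludes one more value; for them the sum does not depend on \<open>t\<close>.\<close>
  let ?bad = "(\<lambda>a. - (\<Sum>v\<in>UNIV. \<kappa> v * a v) / a i) ` insert b A"
  have "finite ?bad" using insert.hyps by simp
  then obtain t where t: "t \<notin> ?bad" using ex_new_if_finite[OF infinite_UNIV_char_0] by blast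
  have eq: "(\<Sum>v\<in>UNIV. (\<kappa>(i := \<kappa> i + t)) v * a v) = (\<Sum>v\<in>UNIV. \<kappa> v * a v) + t * a i" for a
  proof -
    have "(\<Sum>v\<in>UNIV. (\<kappa>(i := \<kappa> i + t)) v * a v) = (\<Sum>v\<in>UNIV. \<kappa> v * a v + (if v = i then t * a i else 0))"
      by (intro sum.cong) (auto simp: distrib_right)
    then show ?thesis by (simp add: sum.distrib)
  qed
  have "(\<Sum>v\<in>UNIV. \<kappa> v * a v) + t * a i \<noteq> 0" if a: "a \<in> insert b A" for a
  proof (cases "a i = 0")
    case True
    then show ?thesis using a i \<kappa> by auto
  next
    case False
    have "t \<noteq> - (\<Sum>v\<in>UNIV. \<kappa> v * a v) / a i" using t a by blast
    then show ?thesis using False by (metis eq_neg_iff_add_eq_0 add.commute nonzero_mult_div_cancel_right)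
  qed
  then show ?case using eq by (intro exI[of _ "\<kappa>(i := \<kappa> i + t)"]) simp
qed simp

lemma exists_avoiding:
  fixes P :: "nat \<Rightarrow> ('k::field_char_0, 'n::finite, 'm::finite) bipoint"
  assumes "\<And>j. j \<in> {1..s} \<Longrightarrow> P j \<in> biproj_space"
  shows "\<exists>\<kappa>. \<forall>j\<in>{1..s}. avoids \<kappa> (P j)"
proof -
  define rep where "rep j a b \<longleftrightarrow> a \<noteq> (\<lambda>_. 0) \<and> b \<noteq> (\<lambda>_. 0) \<and>
      fst (P j) = {\<lambda>i. c * a i |c. c \<noteq> 0} \<and> snd (P j) = {\<lambda>i. c * b i |c. c \<noteq> 0}" for j a b
  have "\<exists>a b. rep j a b" if "j \<in> {1..s}" for j
    unfolding rep_def by (rule biproj_spaceE[OF assms[OF that]]) blast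
  then obtain a b where "rep j (a j) (b j)" if "j \<in> {1..s}" for j
    by metis
  note ab = this[unfolded rep_def]
  \<comment> \<open>Each point gives two vectors, one per factor, extended by zero to all variables.
    One \<open>\<kappa>\<close> for all of these vectors then serves both linear forms.\<close>
  define r where "r j \<beta> v = (if isl v = \<beta> then case_sum (a j) (b j) v else 0)" for j \<beta> v
  let ?A = "(\<lambda>(j, \<beta>). r j \<beta>) ` ({1..s} \<times> UNIV)"
  have nz: "r j \<beta> \<noteq> (\<lambda>_. 0)" if j: "j \<in> {1..s}" for j \<beta>
  proof -
    obtain x where x: "a j x \<noteq> 0" using ab[OF j] by (auto simp: fun_eq_iff)
    obtain y where y: "b j y \<noteq> 0" using ab[OF j] by (auto simp: fun_eq_iff)
    have "r j \<beta> (if \<beta> then Inl x else Inr y) \<noteq> 0" using x y by (simp add: r_def)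
    then show ?thesis by metis
  qed
  have "f \<noteq> (\<lambda>_. 0)" if f: "f \<in> ?A" for f
  proof -
    obtain j \<beta> where "j \<in> {1..s}" "f = r j \<beta>" using f by auto
    then show ?thesis using nz by metis
  qed
  then have "\<exists>\<kappa>. \<forall>f\<in>?A. (\<Sum>v\<in>UNIV. \<kappa> v * f v) \<noteq> 0"
    by (intro exists_common_nonzero) simp
  then obtain \<kappa> where \<kappa>: "\<forall>f\<in>?A. (\<Sum>v\<in>UNIV. \<kappa> v * f v) \<noteq> 0" by blast
  have "avoids \<kappa> (P j)" if j: "j \<in> {1..s}" for j
    unfolding avoids_def
  proof (intro ballI allI)
    fix a' b' \<beta> assume "a' \<in> fst (P j)" "b' \<in> snd (P j)"
    then obtain c d where c: "a' = (\<lambda>i. c * a j i)" "c \<noteq> 0" and d: "b' = (\<lambda>i. d * b j i)" "d \<noteq> 0"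
      using ab[OF j] by auto
    let ?C = "if \<beta> then c else d"
    have "(\<Sum>v | isl v = \<beta>. \<kappa> v * case_sum a' b' v) = (\<Sum>v | isl v = \<beta>. ?C * (\<kappa> v * case_sum (a j) (b j) v))"
      by (intro sum.cong) (auto simp: c d mult.left_commute split: sum.split)
    also have "\<dots> = ?C * (\<Sum>v | isl v = \<beta>. \<kappa> v * case_sum (a j) (b j) v)"
      by (simp add: sum_distrib_left)
    also have "(\<Sum>v | isl v = \<beta>. \<kappa> v * case_sum (a j) (b j) v) = (\<Sum>v\<in>UNIV. \<kappa> v * r j \<beta> v)"
      by (intro sum.mono_neutral_cong_left) (auto simp: r_def)
    also have "?C * \<dots> \<noteq> 0"
    proof -
      have "r j \<beta> \<in> ?A" using j by (intro image_eqI[of _ _ "(j, \<beta>)"]) auto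
      then show ?thesis using \<kappa> c(2) d(2) by auto
    qed
    finally show "(\<Sum>v | isl v = \<beta>. \<kappa> v * case_sum a' b' v) \<noteq> 0" .
  qed
  then show ?thesis by blast
qed

section \<open>Complexes of free modules\<close>

lemma free_mod_add: "v \<in> free_mod as \<Longrightarrow> w \<in> free_mod as \<Longrightarrow> (\<lambda>u. v u + w u) \<in> free_mod as"
  and free_mod_diff: "v \<in> free_mod as \<Longrightarrow> w \<in> free_mod as \<Longrightarrow> (\<lambda>u. v u - w u) \<in> free_mod as"
  and free_mod_scale: "v \<in> free_mod as \<Longrightarrow> (\<lambda>u. r * v u) \<in> free_mod as"
  by (simp_all add: free_mod_def)

definition unit_vec :: "nat \<Rightarrow> nat \<Rightarrow> 'a::zero_neq_one"
  where "unit_vec k u = (if u = k then 1 else 0)"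

lemma unit_vec_free_mod: "k < length as \<Longrightarrow> unit_vec k \<in> free_mod as"
  by (auto simp: free_mod_def unit_vec_def)

lemma unit_vec_free_mod_part:
  fixes as :: "bideg list"
  assumes "k < length as"
  shows "(unit_vec k :: nat \<Rightarrow> ('k::field, 'n::finite, 'm::finite) bipoly) \<in> free_mod_part as (as ! k)"
proof -
  have "(1 :: ('k, 'n, 'm) bipoly) \<in> forms 0" using cst_in_forms[of 1] by simp
  then show ?thesis
    using assms by (auto simp: free_mod_part_def unit_vec_free_mod unit_vec_def intro!: exI[of _ 0])
qed

context
  fixes as bs :: "bideg list"
    and \<phi> :: "(nat \<Rightarrow> ('k::field, 'n::finite, 'm::finite) bipoly) \<Rightarrow> (nat \<Rightarrow> ('k, 'n, 'm) bipoly)"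
  assumes \<phi>: "bigraded_hom as bs \<phi>"
begin

lemma hom_closed: "v \<in> free_mod as \<Longrightarrow> \<phi> v \<in> free_mod bs"
  using \<phi> by (auto simp: bigraded_hom_def)

lemma hom_add: "v \<in> free_mod as \<Longrightarrow> w \<in> free_mod as \<Longrightarrow> \<phi> (\<lambda>u. v u + w u) = (\<lambda>u. \<phi> v u + \<phi> w u)"
  using \<phi> by (auto simp: bigraded_hom_def)

lemma hom_scale: "v \<in> free_mod as \<Longrightarrow> \<phi> (\<lambda>u. r * v u) = (\<lambda>u. r * \<phi> v u)"
  using \<phi> by (auto simp: bigraded_hom_def)

lemma hom_part: "v \<in> free_mod_part as d \<Longrightarrow> \<phi> v \<in> free_mod_part bs d"
  using \<phi> unfolding bigraded_hom_def by blast

lemma hom_zero: "\<phi> (\<lambda>_. 0) = (\<lambda>_. 0)"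
  using hom_scale[of "\<lambda>_. 0" 0] by (simp add: free_mod_def)

lemma hom_diff:
  assumes "v \<in> free_mod as" "w \<in> free_mod as"
  shows "\<phi> (\<lambda>u. v u - w u) = (\<lambda>u. \<phi> v u - \<phi> w u)"
  using hom_add[OF assms(1) free_mod_scale[OF assms(2), of "- 1"]] hom_scale[OF assms(2), of "- 1"] by simp

text \<open>The matrix of a homomorphism, with the images of unit vectors as columns. Additivity is
  available for two summands only, so the coordinates are restored one at a time.\<close>

lemma hom_expand:
  assumes "v \<in> free_mod as"
  shows "\<phi> v u = (\<Sum>k<length as. v k * \<phi> (unit_vec k) u)"
proof -
  have *: "\<phi> (\<lambda>k. if k < l then v k else 0) = (\<lambda>u. \<Sum>k<l. v k * \<phi> (unit_vec k) u)" if "l \<le> length as" for l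
    using that
  proof (induction l)
    case 0
    then show ?case by (simp add: hom_zero)
  next
    case (Suc l)
    let ?w = "\<lambda>k. if k < l then v k else 0"
    have l: "unit_vec l \<in> free_mod as" using Suc.prems by (intro unit_vec_free_mod) simp
    have "(\<lambda>k. if k < Suc l then v k else 0) = (\<lambda>k. ?w k + v l * unit_vec l k)"
      by (auto simp: unit_vec_def fun_eq_iff less_Suc_eq)
    moreover have "?w \<in> free_mod as" using Suc.prems by (auto simp: free_mod_def)
    ultimately show ?case
      using Suc hom_add[OF _ free_mod_scale[OF l], of ?w "v l"] hom_scale[OF l] by simp
  qed
  have "(\<lambda>k. if k < length as then v k else 0) = v"
    using assms by (auto simp: free_mod_def fun_eq_iff)
  then show ?thesis using fun_cong[OF *[OF order_refl], of u] by simp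
qed

text \<open>The entries of the image are combinations of those of \<open>v\<close>; this is how the
  maps act on F tensor R/J.\<close>

lemma hom_ideal:
  assumes "idl.subspace J" "v \<in> free_mod as" "\<And>u. v u \<in> J"
  shows "\<phi> v u \<in> J"
  unfolding hom_expand[OF assms(2)]
proof (rule idl.subspace_sum[OF assms(1)])
  show "v k * \<phi> (unit_vec k) u \<in> J" for k
    using idl.subspace_scale[OF assms(1,3), of "\<phi> (unit_vec k) u" k] by (simp add: mult.commute)
qed

text \<open>The matrix entries of a degree-preserving map are forms, so the map commutes with taking
  components. A preimage modulo a homogeneous ideal can thus be replaced by its component of the
  right degree.\<close>

lemma hom_homogenize:
  assumes y: "y \<in> free_mod_part bs D" and a: "a \<in> free_mod as"
    and J: "homogeneous J" "0 \<in> J" and diff: "\<And>u. y u - \<phi> a u \<in> J"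
  obtains a' where "a' \<in> free_mod_part as D" "\<And>u. y u - \<phi> a' u \<in> J"
proof -
  define a' where "a' k = (if k < length as then hcomp (as ! k) D (a k) else 0)" for k
  have a': "a' \<in> free_mod as" by (simp add: free_mod_def a'_def)
  have part: "a' \<in> free_mod_part as D"
  proof -
    have "a' u = 0 \<or> (\<exists>e. D = as ! u + e \<and> a' u \<in> forms e)" if "u < length as" for u
      using hcomp_cases[of "as ! u" D "a u"] that by (simp add: a'_def)
    then show ?thesis using a' by (simp add: free_mod_part_def)
  qed
  have "y u - \<phi> a' u \<in> J" for u
  proof (cases "u < length bs")
    case True
    have "hcomp (bs ! u) D (a k * \<phi> (unit_vec k) u) = a' k * \<phi> (unit_vec k) u" if k: "k < length as" for k
    proof -
      let ?m = "\<phi> (unit_vec k) u"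
      have "?m = 0 \<or> (\<exists>e. as ! k = bs ! u + e \<and> ?m \<in> forms e)"
        using hom_part[OF unit_vec_free_mod_part[OF k]] True by (auto simp: free_mod_part_def)
      then show ?thesis
      proof (elim disjE exE conjE)
        fix e assume "as ! k = bs ! u + e" "?m \<in> forms e"
        then have "hcomp (bs ! u) D (?m * a k) = ?m * a' k"
          using k by (simp add: hcomp_form_mult a'_def)
        then show ?thesis by (simp only: mult.commute)
      qed simp
    qed
    then have "hcomp (bs ! u) D (\<phi> a u) = \<phi> a' u"
      by (simp add: hom_expand[OF a] hom_expand[OF a'] hcomp_sum)
    moreover have "hcomp (bs ! u) D (y u) = y u"
      using y True by (auto simp: free_mod_part_def hcomp_form)
    ultimately have "hcomp (bs ! u) D (y u - \<phi> a u) = y u - \<phi> a' u" by (simp add: hcomp_diff)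
    then show ?thesis using homogeneousD[OF J(1) diff[of u], of "bs ! u" D] by simp
  next
    case False
    then show ?thesis
      using y hom_closed[OF a'] J(2) by (simp add: free_mod_part_def free_mod_def)
  qed
  then show ?thesis using that part by blast
qed

end

lemma split_free_mod:
  assumes J: "idl.subspace J" and x: "x \<in> free_mod as" "\<And>u. x u \<in> idl.span (insert z J)"
  obtains b where "b \<in> free_mod as" "\<And>u. x u - z * b u \<in> J"
proof -
  have "\<exists>b. x u - z * b \<in> J" for u
    using x(2) idl_span_insert_subspace_iff[OF J] by blast
  then obtain b where b: "x u - z * b u \<in> J" for u by metis
  \<comment> \<open>The pointwise choice is arbitrary beyond the rank and is cut off there to obtain
    a vector of the free module.\<close>
  let ?b = "\<lambda>u. if u < length as then b u else 0"
  have "x u - z * ?b u \<in> J" for u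
    using b[of u] x(1) idl.subspace_0[OF J] by (auto simp: free_mod_def)
  moreover have "?b \<in> free_mod as" by (simp add: free_mod_def)
  ultimately show ?thesis using that by blast
qed

subsection \<open>Resolutions modulo regular sequences\<close>

context
  fixes I :: "('k::field, 'n::finite, 'm::finite) bipoly set"
    and F :: "nat \<Rightarrow> bideg list"
    and \<delta> :: "nat \<Rightarrow> (nat \<Rightarrow> ('k, 'n, 'm) bipoly) \<Rightarrow> (nat \<Rightarrow> ('k, 'n, 'm) bipoly)"
  assumes res: "minimal_free_resolution I F \<delta>" and I: "idl.subspace I"
begin

lemma F_0: "F 0 = [(0, 0)]"
  using res by (simp add: minimal_free_resolution_def)

lemma hom_\<delta>: "bigraded_hom (F (Suc j)) (F j) (\<delta> j)"
  using res by (simp add: minimal_free_resolution_def)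

lemma \<delta>_image_0: "\<delta> 0 ` free_mod (F (Suc 0)) = {v \<in> free_mod (F 0). v 0 \<in> I}"
  using res unfolding minimal_free_resolution_def coset_zero_iff[OF I] by simp

lemma \<delta>_image_Suc: "\<delta> (Suc j) ` free_mod (F (Suc (Suc j))) = {v \<in> free_mod (F (Suc j)). \<delta> j v = (\<lambda>_. 0)}"
  using res unfolding minimal_free_resolution_def by blast

lemma \<delta>_\<delta>: "v \<in> free_mod (F (Suc (Suc j))) \<Longrightarrow> \<delta> j (\<delta> (Suc j) v) = (\<lambda>_. 0)"
  using \<delta>_image_Suc[of j] by blast

lemma \<delta>_minimal: "v \<in> free_mod (F (Suc j)) \<Longrightarrow> \<delta> j v u \<in> idl.span (range var)"
  using res unfolding minimal_free_resolution_def irrelevant_ideal_eq by blast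

text \<open>The homology of \<open>F \<otimes> R/J\<close> vanishes in all degrees greater than \<open>q\<close>.\<close>

definition exact_mod :: "('k, 'n, 'm) bipoly set \<Rightarrow> nat \<Rightarrow> bool"
  where "exact_mod J q \<longleftrightarrow> (\<forall>j\<ge>q. \<forall>w\<in>free_mod (F (Suc j)). (\<forall>u. \<delta> j w u \<in> J) \<longrightarrow>
    (\<exists>a\<in>free_mod (F (Suc (Suc j))). \<forall>u. w u - \<delta> (Suc j) a u \<in> J))"

lemma exact_modD:
  assumes "exact_mod J q" "q \<le> j" "w \<in> free_mod (F (Suc j))" "\<And>u. \<delta> j w u \<in> J"
  obtains a where "a \<in> free_mod (F (Suc (Suc j)))" "\<And>u. w u - \<delta> (Suc j) a u \<in> J"
  using assms unfolding exact_mod_def by blast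

lemma exact_mod_0: "exact_mod (idl.span {}) 0"
  unfolding exact_mod_def
proof (intro allI ballI impI)
  fix j w assume w: "w \<in> free_mod (F (Suc j))" "\<forall>u. \<delta> j w u \<in> idl.span {}"
  then have "\<delta> j w = (\<lambda>_. 0)" by (simp add: fun_eq_iff)
  then have "w \<in> \<delta> (Suc j) ` free_mod (F (Suc (Suc j)))"
    unfolding \<delta>_image_Suc using w(1) by simp
  then obtain a where "a \<in> free_mod (F (Suc (Suc j)))" "\<delta> (Suc j) a = w"
    by blast
  then show "\<exists>a\<in>free_mod (F (Suc (Suc j))). \<forall>u. w u - \<delta> (Suc j) a u \<in> idl.span {}"
    by (intro bexI[of _ a]) simp_all
qed

text \<open>A cycle \<open>w\<close> modulo J + (z) has boundary z b. Once b is itself a boundary of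
  some \<open>a\<close>, the corrected vector w - z a is a cycle modulo \<open>J\<close>, where
  exactness applies.\<close>

lemma exact_mod_lift:
  assumes J: "idl.subspace J" and ex: "exact_mod J q" "q \<le> j"
    and w: "w \<in> free_mod (F (Suc j))" "\<And>u. \<delta> j w u - z * b u \<in> J"
    and a: "a \<in> free_mod (F (Suc j))" "\<And>u. b u - \<delta> j a u \<in> J"
  shows "\<exists>a\<in>free_mod (F (Suc (Suc j))). \<forall>u. w u - \<delta> (Suc j) a u \<in> idl.span (insert z J)"
proof -
  let ?w = "\<lambda>u. w u - z * a u"
  have w': "?w \<in> free_mod (F (Suc j))" using w(1) a(1) by (intro free_mod_diff free_mod_scale)
  have d: "\<delta> j ?w u \<in> J" for u
  proof -
    have "\<delta> j ?w u = (\<delta> j w u - z * b u) + z * (b u - \<delta> j a u)"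
      using hom_diff[OF hom_\<delta> w(1) free_mod_scale[OF a(1)]] hom_scale[OF hom_\<delta> a(1)]
      by (simp add: algebra_simps)
    then show ?thesis using idl.subspace_add[OF J w(2) idl.subspace_scale[OF J a(2)]] by simp
  qed
  obtain a' where a': "a' \<in> free_mod (F (Suc (Suc j)))" "\<And>u. ?w u - \<delta> (Suc j) a' u \<in> J"
    by (rule exact_modD[OF ex w' d], rule that)
  have "w u - \<delta> (Suc j) a' u \<in> idl.span (insert z J)" for u
    using a'(2)[of u] unfolding idl_span_insert_subspace_iff[OF J]
    by (intro exI[of _ "a u"]) (simp add: algebra_simps)
  then show ?thesis using a'(1) by blast
qed

text \<open>Applying the differential to z b and cancelling z shows that b is a cycle modulo
  \<open>J\<close>. Exactness is used one degree below \<open>w\<close>, which is where the range of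
  exactness shrinks.\<close>

lemma boundary_divide:
  assumes J: "idl.subspace J" and nz: "nzd J z" and ex: "exact_mod J q" "q \<le> j"
    and w: "w \<in> free_mod (F (Suc (Suc j)))" and b: "b \<in> free_mod (F (Suc j))"
    and wb: "\<And>u. \<delta> (Suc j) w u - z * b u \<in> J"
  obtains a where "a \<in> free_mod (F (Suc (Suc j)))" "\<And>u. b u - \<delta> (Suc j) a u \<in> J"
proof -
  let ?c = "\<lambda>u. \<delta> (Suc j) w u - z * b u"
  have w': "\<delta> (Suc j) w \<in> free_mod (F (Suc j))" by (rule hom_closed[OF hom_\<delta> w])
  have c: "?c \<in> free_mod (F (Suc j))" by (intro free_mod_diff free_mod_scale w' b)
  have "\<delta> j b u \<in> J" for u
  proof -
    have "\<delta> j ?c u = - (z * \<delta> j b u)"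
      using hom_diff[OF hom_\<delta> w' free_mod_scale[OF b]] hom_scale[OF hom_\<delta> b] \<delta>_\<delta>[OF w] by simp
    moreover have "\<delta> j ?c u \<in> J" by (rule hom_ideal[OF hom_\<delta> J c wb])
    ultimately have "z * \<delta> j b u \<in> J" using idl.subspace_neg[OF J, of "\<delta> j ?c u"] by simp
    then show ?thesis by (rule nzdD[OF nz])
  qed
  then show ?thesis using exact_modD[OF ex b] that by blast
qed

lemma exact_mod_step:
  assumes J: "idl.subspace J" and nz: "nzd J z" and ex: "exact_mod J q"
  shows "exact_mod (idl.span (insert z J)) (Suc q)"
  unfolding exact_mod_def
proof (intro allI ballI impI)
  fix j w assume "Suc q \<le> j" and w: "w \<in> free_mod (F (Suc j))" "\<forall>u. \<delta> j w u \<in> idl.span (insert z J)"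
  then obtain i where j: "j = Suc i" "q \<le> i" by (metis Suc_le_D Suc_le_mono)
  obtain b where b: "b \<in> free_mod (F j)" "\<And>u. \<delta> j w u - z * b u \<in> J"
    using split_free_mod[OF J hom_closed[OF hom_\<delta> w(1)]] w(2) by blast
  obtain a where "a \<in> free_mod (F (Suc j))" "\<And>u. b u - \<delta> j a u \<in> J"
    using boundary_divide[OF J nz ex j(2) w(1)[unfolded j] b[unfolded j]] unfolding j by blast
  then show "\<exists>a\<in>free_mod (F (Suc (Suc j))). \<forall>u. w u - \<delta> (Suc j) a u \<in> idl.span (insert z J)"
    using exact_mod_lift[OF J ex _ w(1) b(2)] \<open>Suc q \<le> j\<close> by simp
qed

text \<open>The only additional degree is 0, where the homology of F tensor R/J is R/(I + J). There
  the second regularity hypothesis replaces exactness.\<close>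

lemma exact_mod_step_regular:
  assumes J: "idl.subspace J" and nz: "nzd J z" "nzd (idl.span (I \<union> J)) z" and ex: "exact_mod J 0"
  shows "exact_mod (idl.span (insert z J)) 0"
  unfolding exact_mod_def
proof (intro allI ballI impI)
  fix j w assume w: "w \<in> free_mod (F (Suc j))" "\<forall>u. \<delta> j w u \<in> idl.span (insert z J)"
  obtain b where b: "b \<in> free_mod (F j)" "\<And>u. \<delta> j w u - z * b u \<in> J"
    using split_free_mod[OF J hom_closed[OF hom_\<delta> w(1)]] w(2) by blast
  have "\<exists>a\<in>free_mod (F (Suc j)). \<forall>u. b u - \<delta> j a u \<in> J"
  proof (cases j)
    case 0
    have "\<delta> 0 w 0 \<in> I" using w(1) \<delta>_image_0 unfolding 0 by blast
    moreover have "\<delta> 0 w 0 - z * b 0 \<in> J" using b(2)[of 0] unfolding 0 .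
    ultimately have "\<delta> 0 w 0 - (\<delta> 0 w 0 - z * b 0) \<in> idl.span (I \<union> J)"
      by (intro idl.span_diff[OF idl.span_base idl.span_base]) auto
    then have "b 0 \<in> idl.span (I \<union> J)" using nzdD[OF nz(2)] by simp
    then obtain i c where ic: "i \<in> I" "c \<in> J" "b 0 = i + c"
      unfolding idl_span_Un_subspace_iff[OF I] iffD2[OF idl.span_eq_iff J] by blast
    have "(\<lambda>u. if u = 0 then i else 0) \<in> {v \<in> free_mod (F 0). v 0 \<in> I}"
      using ic by (simp add: free_mod_def F_0)
    then obtain a where a: "a \<in> free_mod (F (Suc 0))" "\<delta> 0 a = (\<lambda>u. if u = 0 then i else 0)"
      unfolding \<delta>_image_0[symmetric] by force
    have "b u - \<delta> 0 a u \<in> J" for u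
      using b(1) ic idl.subspace_0[OF J] unfolding 0 by (auto simp: a free_mod_def F_0)
    then show ?thesis using a(1) unfolding 0 by blast
  next
    case (Suc i)
    show ?thesis
      using boundary_divide[OF J nz(1) ex le0 w(1)[unfolded Suc] b[unfolded Suc]] unfolding Suc by blast
  qed
  then show "\<exists>a\<in>free_mod (F (Suc (Suc j))). \<forall>u. w u - \<delta> (Suc j) a u \<in> idl.span (insert z J)"
    using exact_mod_lift[OF J ex le0 w(1) b(2)] by blast
qed

lemma exact_mod_list:
  assumes ex: "exact_mod (idl.span S) q"
    and nz: "\<And>r. r < length zs \<Longrightarrow> nzd (idl.span (S \<union> set (take r zs))) (zs ! r)"
    and "r \<le> length zs"
  shows "exact_mod (idl.span (S \<union> set (take r zs))) (q + r)"
  using assms(3)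
proof (induction r)
  case (Suc r)
  have "idl.span (S \<union> set (take (Suc r) zs)) = idl.span (insert (zs ! r) (idl.span (S \<union> set (take r zs))))"
    using Suc.prems by (simp add: take_Suc_conv_app_nth idl_span_insert_span)
  then show ?case using exact_mod_step[OF idl.subspace_span nz Suc.IH] Suc.prems by simp
qed (use ex in simp)

text \<open>Modulo the irrelevant ideal the differentials of a minimal resolution are zero.
  Exactness would therefore put a unit vector, hence 1, into that ideal.\<close>

lemma resolution_vanishes:
  assumes "exact_mod (idl.span (range var)) q" "j > q"
  shows "F j = []"
proof (rule ccontr)
  assume "F j \<noteq> []"
  obtain i where j: "j = Suc i" "q \<le> i" using assms(2) by (metis Suc_le_D Suc_le_eq Suc_le_mono)
  let ?M = "idl.span (range var) :: ('k, 'n, 'm) bipoly set"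
  have e: "unit_vec 0 \<in> free_mod (F (Suc i))"
    using \<open>F j \<noteq> []\<close> unfolding j by (intro unit_vec_free_mod) simp
  obtain a where a: "a \<in> free_mod (F (Suc (Suc i)))" "\<And>u. unit_vec 0 u - \<delta> (Suc i) a u \<in> ?M"
    using exact_modD[OF assms(1) j(2) e] \<delta>_minimal[OF e] by blast
  have "unit_vec 0 0 - \<delta> (Suc i) a 0 + \<delta> (Suc i) a 0 \<in> ?M"
    by (intro idl.span_add a(2) \<delta>_minimal a(1))
  then have "1 \<in> ?M" by (simp add: unit_vec_def)
  then show False by (simp add: mon_ideal_def flip: mon_ideal_1)
qed

section \<open>Chains of connecting maps\<close>

text \<open>
  The class of \<open>f\<close> in \<open>R/I\<close>, killed by the regular sequence \<open>zs\<close>, is pushed through the connecting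
  maps into \<open>F\<^sub>r \<otimes> R/(z\<^sub>0, \<dots>, z\<^sub>r\<^sub>-\<^sub>1)\<close>.
\<close>

definition syzygy_chain :: "('k, 'n, 'm) bipoly list \<Rightarrow> ('k, 'n, 'm) bipoly \<Rightarrow> (nat \<Rightarrow> nat \<Rightarrow> ('k, 'n, 'm) bipoly) \<Rightarrow> bool"
  where "syzygy_chain zs f g \<longleftrightarrow> g 0 = (\<lambda>u. if u = 0 then f else 0) \<and>
    (\<forall>r\<le>length zs. g r \<in> free_mod (F r)) \<and>
    (\<forall>r<length zs. \<forall>u. \<delta> r (g (Suc r)) u - zs ! r * g r u \<in> idl.span (set (take r zs)))"

lemma free_mod_part_form_mult:
  assumes "v \<in> free_mod_part as d" "h \<in> forms e"
  shows "(\<lambda>u. h * v u) \<in> free_mod_part as (d + e)"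
proof -
  have "h * v u = 0 \<or> (\<exists>e'. d + e = as ! u + e' \<and> h * v u \<in> forms e')" if "u < length as" for u
  proof -
    have "v u = 0 \<or> (\<exists>e'. d = as ! u + e' \<and> v u \<in> forms e')"
      using assms(1) that by (simp add: free_mod_part_def)
    then show ?thesis
    proof (elim disjE exE conjE)
      fix e' assume "d = as ! u + e'" "v u \<in> forms e'"
      then show ?thesis using forms_mult[OF assms(2), of "v u" e']
        by (intro disjI2 exI[of _ "e + e'"]) (simp add: ac_simps)
    qed simp
  qed
  then show ?thesis using assms(1) by (simp add: free_mod_part_def free_mod_def)
qed

text \<open>Acyclicity of F modulo the first r elements is enough to carry along the fact that the
  class is killed by the whole sequence, and this fact allows the next connecting map to be undone
  by a lift.\<close>

lemma syzygy_chain_exists: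
  fixes e :: "nat \<Rightarrow> bideg"
  assumes nz: "\<And>r. r < length zs \<Longrightarrow> nzd (idl.span (set (take r zs))) (zs ! r)"
    and e: "\<And>r. r < length zs \<Longrightarrow> zs ! r \<in> forms (e r)"
    and f: "f \<in> forms d" "\<And>z. z \<in> set zs \<Longrightarrow> z * f \<in> I"
  obtains g where "syzygy_chain zs f g" "g (length zs) \<in> free_mod_part (F (length zs)) (d + (\<Sum>k<length zs. e k))"
proof -
  let ?J = "\<lambda>r. idl.span (set (take r zs))"
  have ex: "exact_mod (?J r) r" if "r \<le> length zs" for r
    using exact_mod_list[OF exact_mod_0, of zs r] nz that by simp
  have hom: "homogeneous (?J r)" for r
  proof (rule homogeneous_span)
    fix z assume "z \<in> set (take r zs)"
    then obtain k where "k < length zs" "z = zs ! k" by (metis in_set_conv_nth in_set_takeD)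
    then show "\<exists>d. z \<in> forms d" using e by blast
  qed
  \<comment> \<open>Invariant: \<open>v\<close> has the accumulated degree, and every element of
    \<open>zs\<close>, not merely the next one, turns it into a boundary modulo the elements already
    divided out.\<close>
  define P where "P r v \<longleftrightarrow> v \<in> free_mod_part (F r) (d + (\<Sum>k<r. e k)) \<and>
    (\<forall>z\<in>set zs. \<exists>a\<in>free_mod (F (Suc r)). \<forall>u. z * v u - \<delta> r a u \<in> ?J r)" for r v
  define Q where "Q r v v' \<longleftrightarrow> (\<forall>u. \<delta> r v' u - zs ! r * v u \<in> ?J r)" for r v v'
  let ?f = "\<lambda>u::nat. if u = 0 then f else 0"
  have P0: "P 0 ?f"
    unfolding P_def
  proof (intro conjI ballI)
    show "?f \<in> free_mod_part (F 0) (d + (\<Sum>k<0. e k))"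
      using f(1) by (auto simp: F_0 free_mod_part_def free_mod_def simp flip: zero_prod_def)
    fix z assume "z \<in> set zs"
    then have "(\<lambda>u. z * ?f u) \<in> {v \<in> free_mod (F 0). v 0 \<in> I}"
      using f(2) by (simp add: free_mod_def F_0)
    then obtain a where "a \<in> free_mod (F (Suc 0))" "(\<lambda>u. z * ?f u) = \<delta> 0 a"
      unfolding \<delta>_image_0[symmetric] by blast
    then show "\<exists>a\<in>free_mod (F (Suc 0)). \<forall>u. z * ?f u - \<delta> 0 a u \<in> ?J 0"
      by (intro bexI[of _ a]) (auto simp: fun_eq_iff)
  qed
  have step: "\<exists>v'. P (Suc r) v' \<and> Q r v v'" if r: "r < length zs" and v: "P r v" for r v
  proof -
    let ?z = "zs ! r"
    have z: "?z \<in> set zs" using r by simp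
    have vpart: "v \<in> free_mod_part (F r) (d + (\<Sum>k<r. e k))" using v by (simp add: P_def)
    then have vF: "v \<in> free_mod (F r)" by (simp add: free_mod_part_def)
    obtain a0 where "a0 \<in> free_mod (F (Suc r))" "\<And>u. ?z * v u - \<delta> r a0 u \<in> ?J r"
      using v z unfolding P_def by blast
    with free_mod_part_form_mult[OF vpart e[OF r]]
    obtain a where a: "a \<in> free_mod_part (F (Suc r)) (d + (\<Sum>k<r. e k) + e r)" "\<And>u. ?z * v u - \<delta> r a u \<in> ?J r"
      using hom_homogenize[OF hom_\<delta> _ _ hom idl.span_zero] by metis
    have aF: "a \<in> free_mod (F (Suc r))" using a(1) by (simp add: free_mod_part_def)
    have "\<exists>c\<in>free_mod (F (Suc (Suc r))). \<forall>u. y * a u - \<delta> (Suc r) c u \<in> ?J (Suc r)" if y: "y \<in> set zs" for y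
    proof -
      obtain h where h: "h \<in> free_mod (F (Suc r))" "\<And>u. y * v u - \<delta> r h u \<in> ?J r"
        using v y unfolding P_def by blast
      \<comment> \<open>With z v = d(a) and y v = d(h), the vector y a - z h is a cycle modulo the
        current ideal, hence a boundary. Modulo z as well, this makes y a a boundary, so
        \<open>a\<close> inherits the invariant.\<close>
      let ?w = "\<lambda>u. y * a u - ?z * h u"
      have wF: "?w \<in> free_mod (F (Suc r))" by (intro free_mod_diff free_mod_scale aF h(1))
      have d: "\<delta> r ?w u \<in> ?J r" for u
      proof -
        have "\<delta> r ?w u = y * \<delta> r a u - ?z * \<delta> r h u"
          using hom_diff[OF hom_\<delta> free_mod_scale[OF aF] free_mod_scale[OF h(1)]]
            hom_scale[OF hom_\<delta> aF] hom_scale[OF hom_\<delta> h(1)] by simp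
        also have "\<dots> = ?z * (y * v u - \<delta> r h u) - y * (?z * v u - \<delta> r a u)"
          by (simp add: algebra_simps)
        finally have "\<delta> r ?w u = \<dots>" .
        then show ?thesis by (simp only:) (intro idl.span_diff idl.span_scale h(2) a(2))
      qed
      obtain c where c: "c \<in> free_mod (F (Suc (Suc r)))" "\<And>u. ?w u - \<delta> (Suc r) c u \<in> ?J r"
        by (rule exact_modD[OF ex[OF less_imp_le[OF r]] order_refl wF d], rule that)
      have "y * a u - \<delta> (Suc r) c u \<in> ?J (Suc r)" for u
      proof -
        have "y * a u - \<delta> (Suc r) c u = (?w u - \<delta> (Suc r) c u) + h u * ?z" by (simp add: algebra_simps)
        also have "\<dots> \<in> ?J (Suc r)"
        proof (intro idl.span_add idl.span_scale)
          show "?w u - \<delta> (Suc r) c u \<in> ?J (Suc r)"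
            using c(2) idl.span_mono[OF set_take_subset_set_take[of r "Suc r" zs]] by auto
          show "?z \<in> ?J (Suc r)" using r by (intro idl.span_base) (simp add: take_Suc_conv_app_nth)
        qed
        finally show ?thesis .
      qed
      then show ?thesis using c(1) by blast
    qed
    moreover have "\<delta> r a u - ?z * v u \<in> ?J r" for u
      using idl.span_neg[OF a(2)[of u]] by simp
    ultimately show ?thesis using a(1) by (intro exI[of _ a]) (simp add: P_def Q_def add.assoc)
  qed
  have "\<exists>g. g 0 = ?f \<and> (\<forall>r\<le>l. P r (g r)) \<and> (\<forall>r<l. Q r (g r) (g (Suc r)))" if "l \<le> length zs" for l
    using that
  proof (induction l)
    case 0
    then show ?case using P0 by (intro exI[of _ "\<lambda>_. ?f"]) simp
  next
    case (Suc l)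
    then obtain g where g: "g 0 = ?f" "\<forall>r\<le>l. P r (g r)" "\<forall>r<l. Q r (g r) (g (Suc r))" by auto
    then obtain v where v: "P (Suc l) v" "Q l (g l) v" using step[of l "g l"] Suc.prems by auto
    show ?case
      using g v by (intro exI[of _ "g(Suc l := v)"]) (auto simp: le_Suc_eq less_Suc_eq)
  qed
  then obtain g where g: "g 0 = ?f" "\<And>r. r \<le> length zs \<Longrightarrow> P r (g r)"
    "\<And>r. r < length zs \<Longrightarrow> Q r (g r) (g (Suc r))" by blast
  show ?thesis
  proof (rule that)
    show "syzygy_chain zs f g"
      using g unfolding syzygy_chain_def P_def Q_def free_mod_part_def by blast
    show "g (length zs) \<in> free_mod_part (F (length zs)) (d + (\<Sum>k<length zs. e k))"
      using g(2)[OF order_refl] by (simp add: P_def)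
  qed
qed

lemma syzygy_chain_sum:
  assumes "finite A" "\<And>x. x \<in> A \<Longrightarrow> syzygy_chain zs (f x) (g x)"
  shows "syzygy_chain zs (\<Sum>x\<in>A. c x * f x) (\<lambda>r u. \<Sum>x\<in>A. c x * g x r u)"
  using assms
proof (induction A)
  case empty
  show ?case
    by (simp add: syzygy_chain_def free_mod_def hom_zero[OF hom_\<delta>] idl.span_zero)
next
  case (insert x A)
  let ?h = "\<lambda>r u. \<Sum>x\<in>A. c x * g x r u"
  have x: "syzygy_chain zs (f x) (g x)" and A: "syzygy_chain zs (\<Sum>x\<in>A. c x * f x) ?h" using insert by auto
  have sum: "(\<lambda>r u. \<Sum>x\<in>insert x A. c x * g x r u) = (\<lambda>r u. c x * g x r u + ?h r u)"
    using insert.hyps by simp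
  have "\<delta> r (\<lambda>u. c x * g x (Suc r) u + ?h (Suc r) u) u - zs ! r * (c x * g x r u + ?h r u)
      \<in> idl.span (set (take r zs))" if r: "r < length zs" for r u
  proof -
    have gF: "g x (Suc r) \<in> free_mod (F (Suc r))" "?h (Suc r) \<in> free_mod (F (Suc r))"
      using x A r by (auto simp: syzygy_chain_def)
    have "\<delta> r (\<lambda>u. c x * g x (Suc r) u + ?h (Suc r) u) u - zs ! r * (c x * g x r u + ?h r u) =
        c x * (\<delta> r (g x (Suc r)) u - zs ! r * g x r u) + (\<delta> r (?h (Suc r)) u - zs ! r * ?h r u)"
      using hom_add[OF hom_\<delta> free_mod_scale[OF gF(1)] gF(2)] hom_scale[OF hom_\<delta> gF(1)]
      by (simp add: algebra_simps)
    also have "\<dots> \<in> idl.span (set (take r zs))"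
      using x A r by (intro idl.span_add idl.span_scale) (auto simp: syzygy_chain_def)
    finally show ?thesis .
  qed
  then show ?case
    unfolding sum syzygy_chain_def
    using x A insert.hyps by (auto simp: syzygy_chain_def free_mod_add free_mod_scale fun_eq_iff)
qed

text \<open>Downward induction shows that \<open>g r\<close> is a boundary modulo \<open>S\<close>
  and the first r elements. At r = 0 this says that \<open>f\<close> lies in the image of the first
  differential modulo \<open>S\<close>, that is, in I + (S).\<close>

lemma syzygy_chain_descend:
  assumes g: "syzygy_chain zs f g"
    and nz: "\<And>r. r < length zs \<Longrightarrow> nzd (idl.span (S \<union> set (take r zs))) (zs ! r)"
    and last: "\<And>u. g (length zs) u \<in> idl.span (S \<union> set zs)"
  shows "f \<in> idl.span (I \<union> S)"
proof -
  let ?K = "\<lambda>r. idl.span (S \<union> set (take r zs))"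
  have gF: "g r \<in> free_mod (F r)" if "r \<le> length zs" for r using g that by (simp add: syzygy_chain_def)
  have "\<exists>a\<in>free_mod (F (Suc 0)). \<forall>u. g 0 u - \<delta> 0 a u \<in> ?K 0"
  proof (rule inc_induct[of 0 "length zs"])
    show "\<exists>a\<in>free_mod (F (Suc (length zs))). \<forall>u. g (length zs) u - \<delta> (length zs) a u \<in> ?K (length zs)"
      \<comment> \<open>At the top no boundary is required: the last vector already lies in the
        ideal.\<close>
      using last hom_zero[OF hom_\<delta>] by (intro bexI[of _ "\<lambda>_. 0"]) (simp_all add: free_mod_def)
  next
    fix r assume r: "r < length zs"
      and "\<exists>a\<in>free_mod (F (Suc (Suc r))). \<forall>u. g (Suc r) u - \<delta> (Suc r) a u \<in> ?K (Suc r)"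
    then obtain a where a: "a \<in> free_mod (F (Suc (Suc r)))" "\<And>u. g (Suc r) u - \<delta> (Suc r) a u \<in> ?K (Suc r)"
      by blast
    let ?z = "zs ! r"
    have K_Suc: "?K (Suc r) = idl.span (insert ?z (?K r))"
      using r by (simp add: take_Suc_conv_app_nth idl_span_insert_span)
    have \<delta>a: "\<delta> (Suc r) a \<in> free_mod (F (Suc r))" by (rule hom_closed[OF hom_\<delta> a(1)])
    have gS: "g (Suc r) \<in> free_mod (F (Suc r))" using gF r by simp
    let ?x = "\<lambda>u. g (Suc r) u - \<delta> (Suc r) a u"
    have xF: "?x \<in> free_mod (F (Suc r))" by (intro free_mod_diff gS \<delta>a)
    obtain b where b: "b \<in> free_mod (F (Suc r))" "\<And>u. ?x u - ?z * b u \<in> ?K r"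
      using split_free_mod[OF idl.subspace_span xF] a(2) unfolding K_Suc by blast
    have "g r u - \<delta> r b u \<in> ?K r" for u
    proof -
      have "\<delta> r (\<lambda>u. ?x u - ?z * b u) u \<in> ?K r"
        by (rule hom_ideal[OF hom_\<delta> idl.subspace_span _ b(2)]) (intro free_mod_diff free_mod_scale xF b(1))
      moreover have "\<delta> r (\<lambda>u. ?x u - ?z * b u) u = \<delta> r (g (Suc r)) u - ?z * \<delta> r b u"
        using hom_diff[OF hom_\<delta> xF free_mod_scale[OF b(1)]] hom_diff[OF hom_\<delta> gS \<delta>a]
          hom_scale[OF hom_\<delta> b(1)] \<delta>_\<delta>[OF a(1)] by simp
      ultimately have "\<delta> r (g (Suc r)) u - ?z * \<delta> r b u \<in> ?K r" by simp
      moreover have "\<delta> r (g (Suc r)) u - ?z * g r u \<in> idl.span (set (take r zs))"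
        using g r by (simp add: syzygy_chain_def)
      then have "\<delta> r (g (Suc r)) u - ?z * g r u \<in> ?K r"
        using idl.span_mono[of "set (take r zs)" "S \<union> set (take r zs)"] by blast
      ultimately have "(\<delta> r (g (Suc r)) u - ?z * \<delta> r b u) - (\<delta> r (g (Suc r)) u - ?z * g r u) \<in> ?K r"
        by (rule idl.span_diff)
      \<comment> \<open>Writing g_(r+1) as a boundary plus z b and applying the differential gives z
        d(b), which is also z g_r by the chain condition. The factor z is regular and can be
        cancelled.\<close>
      then have "?z * (g r u - \<delta> r b u) \<in> ?K r" by (simp add: algebra_simps)
      then show ?thesis by (rule nzdD[OF nz[OF r]])
    qed
    then show "\<exists>a\<in>free_mod (F (Suc r)). \<forall>u. g r u - \<delta> r a u \<in> ?K r" using b(1) by blast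
  qed simp
  then obtain a where a: "a \<in> free_mod (F (Suc 0))" "g 0 0 - \<delta> 0 a 0 \<in> idl.span S" by auto
  have "\<delta> 0 a 0 \<in> I" using a(1) \<delta>_image_0 by blast
  moreover have "f = \<delta> 0 a 0 + (f - \<delta> 0 a 0)" "f - \<delta> 0 a 0 \<in> idl.span S"
    using a(2) g by (simp_all add: syzygy_chain_def)
  ultimately show ?thesis unfolding idl_span_Un_subspace_iff[OF I] by blast
qed

end

section \<open>Counting generators\<close>

text \<open>Gaussian elimination: a pivot \<open>x\<close> clears the coordinate \<open>b\<close> in
  the other vectors, and the coefficient of \<open>x\<close> is afterwards chosen so that the
  equation for \<open>b\<close> holds.\<close>

lemma exists_linear_relation:
  fixes M :: "'a \<Rightarrow> 'b \<Rightarrow> 'k::field"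
  assumes "finite B" "finite A" "card B < card A"
  shows "\<exists>c. (\<exists>x\<in>A. c x \<noteq> 0) \<and> (\<forall>b\<in>B. (\<Sum>x\<in>A. c x * M x b) = 0)"
  using assms
proof (induction B arbitrary: A M)
  case empty
  then have "A \<noteq> {}" by auto
  then show ?case by (intro exI[of _ "\<lambda>_. 1"]) auto
next
  case (insert b B)
  show ?case
  proof (cases "\<forall>x\<in>A. M x b = 0")
    case True
    have "card B < card A" using insert.prems insert.hyps by simp
    then show ?thesis using insert.IH[OF insert.prems(1), of M] True by auto
  next
    case False
    then obtain x where x: "x \<in> A" "M x b \<noteq> 0" by blast
    let ?A = "A - {x}" and ?r = "\<lambda>y. M y b / M x b"
    have "card B < card ?A" using insert.prems insert.hyps x(1) by simp
    then obtain c where c: "\<exists>y\<in>?A. c y \<noteq> 0" "\<forall>\<beta>\<in>B. (\<Sum>y\<in>?A. c y * (M y \<beta> - ?r y * M x \<beta>)) = 0"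
      using insert.IH[of ?A "\<lambda>y \<beta>. M y \<beta> - ?r y * M x \<beta>"] insert.prems(1) by auto
    let ?c = "c(x := - (\<Sum>y\<in>?A. c y * ?r y))"
    have eq: "(\<Sum>y\<in>A. ?c y * M y \<beta>) = (\<Sum>y\<in>?A. c y * (M y \<beta> - ?r y * M x \<beta>))" for \<beta>
    proof -
      have "(\<Sum>y\<in>A. ?c y * M y \<beta>) = ?c x * M x \<beta> + (\<Sum>y\<in>?A. ?c y * M y \<beta>)"
        by (rule sum.remove[OF insert.prems(1) x(1)])
      also have "(\<Sum>y\<in>?A. ?c y * M y \<beta>) = (\<Sum>y\<in>?A. c y * M y \<beta>)" by (intro sum.cong) auto
      finally show ?thesis
        by (simp add: right_diff_distrib sum_subtractf sum_distrib_right mult.assoc)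
    qed
    have "(\<Sum>y\<in>?A. c y * (M y b - ?r y * M x b)) = 0" using x(2) by (intro sum.neutral) simp
    then have "\<forall>\<beta>\<in>insert b B. (\<Sum>y\<in>A. ?c y * M y \<beta>) = 0" unfolding eq using c(2) by simp
    moreover have "\<exists>y\<in>A. ?c y \<noteq> 0" using c(1) by auto
    ultimately show ?thesis by blast
  qed
qed

lemma lookup_cst_times:
  fixes f :: "('v \<Rightarrow>\<^sub>0 nat) \<Rightarrow>\<^sub>0 'k::field"
  shows "Poly_Mapping.lookup (cst c * f) t = c * Poly_Mapping.lookup f t"
  by (induction f rule: poly_single_induct)
     (auto simp: mult_single lookup_single when_def distrib_left lookup_add)

lemma monom_deg_eq_0: "monom_deg t = 0 \<Longrightarrow> t = 0"
proof (rule poly_mapping_eqI)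
  fix v assume "monom_deg t = 0"
  then show "Poly_Mapping.lookup t v = Poly_Mapping.lookup 0 v"
    by (cases v) (auto simp: monom_deg_def zero_prod_def)
qed

lemma in_irrelevant_iff:
  fixes f :: "(('v::finite \<Rightarrow>\<^sub>0 nat) \<Rightarrow>\<^sub>0 'k::field)"
  shows "f \<in> idl.span (range var) \<longleftrightarrow> Poly_Mapping.lookup f 0 = 0"
proof -
  have "(\<Sum>v\<in>UNIV. Poly_Mapping.lookup t v) = 0 \<longleftrightarrow> t = 0" for t :: "'v \<Rightarrow>\<^sub>0 nat"
    by (auto intro: poly_mapping_eqI)
  then show ?thesis
    by (auto simp: mon_ideal_def Suc_le_eq in_keys_iff simp flip: mon_ideal_1 neq0_conv)
qed

text \<open>With shift equal to the target degree, the component is the constant term, and elements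
  of the irrelevant ideal have none.\<close>

lemma hcomp_irrelevant:
  assumes "f \<in> idl.span (range var)"
  shows "hcomp d d f = 0"
  using assms by (intro poly_mapping_eqI)
    (auto simp: lookup_hcomp when_def in_irrelevant_iff dest: monom_deg_eq_0)

text \<open>A graded version of Nakayama's lemma for \<open>I'/I\<close> modulo a regular sequence on \<open>R/I'\<close>.\<close>

lemma separators_independent:
  fixes I I' :: "('k::field, 'n::finite, 'm::finite) bipoly set"
  assumes I: "idl.subspace I" "homogeneous I" and I': "idl.subspace I'" and sub: "I \<subseteq> I'"
    and l: "l1 \<in> idl.span (range var)" "l2 \<in> idl.span (range var)"
    and nz: "nzd I' l1" "nzd (idl.span (insert l1 I')) l2"
    and sep: "minimal_separators I I' S" and A: "A \<subseteq> S" "\<And>f. f \<in> A \<Longrightarrow> f \<in> forms d"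
    and rel: "(\<Sum>f\<in>A. cst (c f) * f) \<in> idl.span (I \<union> {l1, l2})"
  shows "\<forall>f\<in>A. c f = 0"
proof (rule ccontr)
  assume "\<not> ?thesis"
  then obtain f0 where f0: "f0 \<in> A" "c f0 \<noteq> 0" by blast
  have fin: "finite S" and gen: "I' = idl.span (I \<union> S)" and form: "\<forall>f\<in>S. \<exists>d. f \<in> forms d"
    and min: "\<And>T. finite T \<Longrightarrow> card T < card S \<Longrightarrow> I' \<noteq> idl.span (I \<union> T)"
    using sep unfolding minimal_separators_def quot_generators_iff[OF I(1) I' sub] by auto
  \<comment> \<open>The zero form has every degree, so a degree must be chosen for each separator.
    On \<open>A\<close> it is fixed to be \<open>d\<close>, which the comparison below depends
    on.\<close>
  define dg where "dg f = (if f \<in> A then d else SOME e. f \<in> forms e)" for f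
  have dg: "f \<in> forms (dg f)" if "f \<in> S" for f
    using A(2) form that by (auto simp: dg_def intro: someI_ex)
  let ?x = "\<Sum>f\<in>A. cst (c f) * f"
  have S_sub: "S \<subseteq> I'" unfolding gen using idl.span_superset by blast
  have xI': "?x \<in> I'" using S_sub A(1) by (intro idl.subspace_sum[OF I'] idl.subspace_scale[OF I']) blast
  have sing: "idl.span {l1, l2} = {l1 * r + l2 * s |r s. True}"
    by (auto simp: idl_span_insert_iff idl.span_singleton mult.commute) (metis add.commute mult.commute)+
  obtain a r s where a: "a \<in> I" and x: "?x = a + (l1 * r + l2 * s)"
    using rel unfolding idl_span_Un_subspace_iff[OF I(1)] sing by blast
  have "?x - a \<in> I'" using xI' a sub by (intro idl.subspace_diff[OF I']) auto
  \<comment> \<open>The trivial Koszul relation is subtracted: regularity on R/I' gives s = l1 t and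
    r = - l2 t modulo \<open>I'\<close>. Passing to r + l2 t and s - l1 t keeps the combination and
    puts both coefficients into \<open>I'\<close>.\<close>
  then have rs: "l1 * r + l2 * s \<in> I'" unfolding x by simp
  then have "l2 * s \<in> idl.span (insert l1 I')"
    unfolding idl_span_insert_subspace_iff[OF I'] by (intro exI[of _ "- r"]) (simp add: add.commute)
  then have "s \<in> idl.span (insert l1 I')" by (rule nzdD[OF nz(2)])
  then obtain t where t: "s - l1 * t \<in> I'" unfolding idl_span_insert_subspace_iff[OF I'] by blast
  have "l1 * (r + l2 * t) = (l1 * r + l2 * s) - l2 * (s - l1 * t)" by (simp add: algebra_simps)
  also have "\<dots> \<in> I'" by (intro idl.subspace_diff[OF I'] idl.subspace_scale[OF I'] rs t)
  finally have r': "r + l2 * t \<in> I'" by (rule nzdD[OF nz(1)])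
  have expand: "\<exists>b\<in>I. \<exists>u. y = b + (\<Sum>f\<in>S. u f * f)" if "y \<in> I'" for y
    using that unfolding gen idl_span_Un_subspace_iff[OF I(1)] idl.span_finite[OF fin] by blast
  obtain b1 u1 where 1: "b1 \<in> I" "r + l2 * t = b1 + (\<Sum>f\<in>S. u1 f * f)" using expand[OF r'] by blast
  obtain b2 u2 where 2: "b2 \<in> I" "s - l1 * t = b2 + (\<Sum>f\<in>S. u2 f * f)" using expand[OF t] by blast
  define w where "w f = l1 * u1 f + l2 * u2 f" for f
  have w: "w f \<in> idl.span (range var)" for f
    unfolding w_def mult.commute[of _ "u1 f"] mult.commute[of _ "u2 f"]
    by (intro idl.span_add idl.span_scale l)
  have "?x = a + (l1 * (r + l2 * t) + l2 * (s - l1 * t))" unfolding x by (simp add: algebra_simps)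
  also have "\<dots> = (a + l1 * b1 + l2 * b2) + (\<Sum>f\<in>S. w f * f)"
    unfolding 1(2) 2(2) w_def by (simp add: algebra_simps sum.distrib sum_distrib_left)
  finally have "?x - (\<Sum>f\<in>S. w f * f) = a + l1 * b1 + l2 * b2" by simp
  also have "\<dots> \<in> I" by (intro idl.subspace_add[OF I(1)] idl.subspace_scale[OF I(1)] a 1(1) 2(1))
  finally have "hcomp 0 d (?x - (\<Sum>f\<in>S. w f * f)) \<in> I" by (rule homogeneousD[OF I(2)])
  moreover have "hcomp 0 d ?x = ?x"
  proof -
    have "?x \<in> forms d" by (intro forms_sum forms_cst_mult A(2))
    then show ?thesis by (simp add: hcomp_form)
  qed
  moreover have "hcomp 0 d (\<Sum>f\<in>S. w f * f) = (\<Sum>f\<in>S. hcomp (dg f) d (w f) * f)"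
    unfolding hcomp_sum
  proof (rule sum.cong)
    fix f assume "f \<in> S"
    then show "hcomp 0 d (w f * f) = hcomp (dg f) d (w f) * f"
      using hcomp_form_mult[OF dg, of f 0 d "w f"] by (simp add: mult.commute)
  qed simp
  moreover have "(\<Sum>f\<in>S. hcomp (dg f) d (w f) * f) = (\<Sum>f\<in>S - {f0}. hcomp (dg f) d (w f) * f)"
  proof (rule sum.mono_neutral_right[OF fin])
    have "hcomp (dg f0) d (w f0) = 0" using f0(1) hcomp_irrelevant[OF w] by (simp add: dg_def)
    then show "\<forall>f\<in>S - (S - {f0}). hcomp (dg f) d (w f) * f = 0" by auto
  qed auto
  moreover have "?x = cst (c f0) * f0 + (\<Sum>f\<in>A - {f0}. cst (c f) * f)"
    using f0(1) finite_subset[OF A(1) fin] by (simp add: sum.remove)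
  ultimately have "cst (c f0) * f0 + (\<Sum>f\<in>A - {f0}. cst (c f) * f) - (\<Sum>f\<in>S - {f0}. hcomp (dg f) d (w f) * f) \<in> I"
    (is "_ + ?y - ?z \<in> I") by (simp add: hcomp_diff)
  then have 3: "cst (c f0) * f0 + ?y - ?z \<in> idl.span (I \<union> (S - {f0}))" by (intro idl.span_base) blast
  have yz: "?y \<in> idl.span (I \<union> (S - {f0}))" "?z \<in> idl.span (I \<union> (S - {f0}))"
    using A(1) by (auto intro!: idl.span_sum idl.span_scale intro: idl.span_base)
  have "(cst (c f0) * f0 + ?y - ?z) - ?y + ?z \<in> idl.span (I \<union> (S - {f0}))"
    by (intro idl.span_add idl.span_diff 3 yz)
  then have "cst (c f0) * f0 \<in> idl.span (I \<union> (S - {f0}))" by simp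
  then have "cst (1 / c f0) * (cst (c f0) * f0) \<in> idl.span (I \<union> (S - {f0}))" by (rule idl.span_scale)
  moreover have "cst (1 / c f0) * (cst (c f0) * f0) = cst (1 / c f0 * c f0) * f0"
    by (simp only: cst_mult mult.assoc)
  ultimately have "f0 \<in> idl.span (I \<union> (S - {f0}))" using f0(2) by simp
  then have "I \<union> S \<subseteq> idl.span (I \<union> (S - {f0}))" by (auto intro: idl.span_base)
  then have "I' = idl.span (I \<union> (S - {f0}))"
    unfolding gen by (intro equalityI idl.span_minimal idl.span_mono) auto
  moreover have "card (S - {f0}) < card S" using f0(1) A(1) fin by (intro psubset_card_mono) auto
  ultimately show False using min[of "S - {f0}"] fin by blast
qed

lemma free_mod_part_lookup_0:
  assumes "v \<in> free_mod_part as D" "u < length as" "as ! u \<noteq> D"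
  shows "Poly_Mapping.lookup (v u) 0 = 0"
proof (rule ccontr)
  assume *: "Poly_Mapping.lookup (v u) 0 \<noteq> 0"
  then have "v u \<noteq> 0" by auto
  then obtain e where e: "D = as ! u + e" "v u \<in> forms e" using assms(1,2) by (auto simp: free_mod_part_def)
  have "0 \<in> Poly_Mapping.keys (v u)" using * by (simp add: in_keys_iff)
  then have "e = 0" using e(2) by (auto simp: forms_def)
  then show False using e(1) assms(3) by simp
qed

lemma count_mset_nth: "count (mset xs) x = card {k. k < length xs \<and> xs ! k = x}"
  by (simp add: count_mset count_list_eq_length_filter length_filter_conv_card eq_commute)

lemma bigraded_iso_permutation:
  assumes "mset as = mset bs"
  shows "\<exists>\<phi> :: (nat \<Rightarrow> ('k::field, 'n::finite, 'm::finite) bipoly) \<Rightarrow> _. bigraded_iso as bs \<phi>"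
proof -
  obtain f where f: "bij_betw f {..<length bs} {..<length as}" "\<And>u. u < length bs \<Longrightarrow> bs ! u = as ! f u"
    using permutation_Ex_bij[of bs as] assms by auto
  have f_lt: "f u < length as" if "u < length bs" for u using bij_betwE[OF f(1)] that by auto
  let ?g = "the_inv_into {..<length bs} f"
  have gf: "?g (f u) = u" if "u < length bs" for u
    using the_inv_into_f_f[OF bij_betw_imp_inj_on[OF f(1)]] that by simp
  have fg: "f (?g k) = k" "?g k < length bs" if "k < length as" for k
    using f_the_inv_into_f_bij_betw[OF f(1)] bij_betwE[OF bij_betw_the_inv_into[OF f(1)]] that by auto
  define \<phi> :: "(nat \<Rightarrow> ('k, 'n, 'm) bipoly) \<Rightarrow> nat \<Rightarrow> ('k, 'n, 'm) bipoly"
    where "\<phi> v u = (if u < length bs then v (f u) else 0)" for v u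
  define \<psi> :: "(nat \<Rightarrow> ('k, 'n, 'm) bipoly) \<Rightarrow> nat \<Rightarrow> ('k, 'n, 'm) bipoly"
    where "\<psi> w k = (if k < length as then w (?g k) else 0)" for w k
  have "\<phi> v \<in> free_mod_part bs d" if "v \<in> free_mod_part as d" for v d
    using that f(2) f_lt by (auto simp: free_mod_part_def free_mod_def \<phi>_def)
  then have "bigraded_hom as bs \<phi>"
    unfolding bigraded_hom_def by (auto simp: free_mod_def \<phi>_def fun_eq_iff)
  moreover have "bij_betw \<phi> (free_mod as) (free_mod bs)"
    by (rule bij_betw_byWitness[where f' = \<psi>]) (auto simp: \<phi>_def \<psi>_def free_mod_def fun_eq_iff gf fg f_lt)
  ultimately show ?thesis unfolding bigraded_iso_def by blast
qed

section \<open>The shift by (n,m) and multiplication from I_Z' into I_Z\<close>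

text \<open>The origin of N and of the shift: of the n + 1 and m + 1 coordinates, one pivot in each
  block is taken by l_1 or l_2.\<close>

lemma sum_var_deg:
  fixes q :: "bool \<Rightarrow> 'n::finite + 'm::finite"
  assumes q: "\<And>\<beta>. isl (q \<beta>) = \<beta>" and "CARD('n) = n + 1" "CARD('m) = m + 1"
  shows "card {v. v \<noteq> q (isl v)} = n + m" and "(\<Sum>v | v \<noteq> q (isl v). var_deg v) = (n, m)"
proof -
  obtain x where x: "q True = Inl x" using q[of True] by (cases "q True") auto
  obtain y where y: "q False = Inr y" using q[of False] by (cases "q False") auto
  have W: "{v. v \<noteq> q (isl v)} = Inl ` (UNIV - {x}) \<union> Inr ` (UNIV - {y})"
  proof (rule equalityI; rule subsetI)
    fix v assume "v \<in> {v. v \<noteq> q (isl v)}"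
    then show "v \<in> Inl ` (UNIV - {x}) \<union> Inr ` (UNIV - {y})" using x y by (cases v) auto
  qed (use x y in auto)
  have c: "card (UNIV - {x}) = n" "card (UNIV - {y}) = m" using assms(2,3) by simp_all
  show "card {v. v \<noteq> q (isl v)} = n + m"
    unfolding W by (subst card_Un_disjoint) (auto simp: card_image c)
  have "(\<Sum>v | v \<noteq> q (isl v). var_deg v) = (\<Sum>i\<in>UNIV - {x}. (1, 0)) + (\<Sum>j\<in>UNIV - {y}. (0, 1))"
    unfolding W by (subst sum.union_disjoint) (auto simp: sum.reindex var_deg_def)
  also have "\<dots> = (n, m)" by (rule prod_eqI) (simp_all add: fst_sum snd_sum c)
  finally show "(\<Sum>v | v \<noteq> q (isl v). var_deg v) = (n, m)" .
qed

text \<open>Only the factor at \<open>P i\<close> changes, where one further multiplication by the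
  point ideal raises the power from \<open>\<mu> i - 1\<close> to \<open>\<mu> i\<close>. The other
  factors are ideals and absorb \<open>z\<close>.\<close>

lemma fat_ideal_step:
  assumes i: "i \<in> {1..s}" "\<mu> i > 0" and P: "\<And>j. j \<in> {1..s} \<Longrightarrow> P j \<in> biproj_space"
    and \<kappa>: "\<And>j. j \<in> {1..s} \<Longrightarrow> avoids \<kappa> (P j)"
  shows "fat_ideal s P \<mu> \<subseteq> fat_ideal s P (\<mu>(i := \<mu> i - 1))"
    and "z \<in> point_ideal (P i) \<Longrightarrow> f \<in> fat_ideal s P (\<mu>(i := \<mu> i - 1)) \<Longrightarrow> z * f \<in> fat_ideal s P \<mu>"
proof -
  let ?I = "\<lambda>j k. point_ideal (P j) [^]\<^bsub>ideals_set coord_ring\<^esub> (k :: nat)"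
  obtain k where k: "\<mu> i = Suc k" using i(2) gr0_implies_Suc by blast
  have sub: "idl.subspace (?I j k)" if "j \<in> {1..s}" for j k using point_power(1)[OF P[OF that] \<kappa>[OF that]] .
  have subi: "idl.subspace (point_ideal (P i))"
    unfolding point_ideal_def genideal_type_algebra by simp
  have step: "?I i (Suc k) \<subseteq> ?I i k"
    using ring.ideal_prod_inter[OF ring_from_type_algebra] sub[OF i(1)] subi
    unfolding ideals_set_pow_Suc ideal_type_algebra_iff by blast
  then show "fat_ideal s P \<mu> \<subseteq> fat_ideal s P (\<mu>(i := \<mu> i - 1))"
    unfolding fat_ideal_def
  proof (intro INT_greatest)
    fix j assume "j \<in> {1..s}"
    then have "(\<Inter>j\<in>{1..s}. ?I j (\<mu> j)) \<subseteq> ?I j (\<mu> j)" by blast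
    also have "\<dots> \<subseteq> ?I j ((\<mu>(i := \<mu> i - 1)) j)" using step k by (cases "j = i") simp_all
    finally show "(\<Inter>j\<in>{1..s}. ?I j (\<mu> j)) \<subseteq> ?I j ((\<mu>(i := \<mu> i - 1)) j)" .
  qed
  assume z: "z \<in> point_ideal (P i)" and f: "f \<in> fat_ideal s P (\<mu>(i := \<mu> i - 1))"
  have "z * f \<in> ?I j (\<mu> j)" if j: "j \<in> {1..s}" for j
  proof (cases "j = i")
    case True
    have "f \<in> ?I i k" using f i(1) k unfolding fat_ideal_def by force
    then show ?thesis
      unfolding True k ideals_set_pow_Suc
      using ideal_prod.prod[OF _ z, of f _ coord_ring] by (simp add: type_algebra_sel mult.commute)
  next
    case False
    then have "f \<in> ?I j (\<mu> j)" using f j unfolding fat_ideal_def by force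
    then show ?thesis by (rule idl.subspace_scale[OF sub[OF j]])
  qed
  then show "z * f \<in> fat_ideal s P \<mu>" by (simp add: fat_ideal_def)
qed

text \<open>The isomorphism only has to reorder generators, so the claim on F_N reduces to an
  inclusion of multisets of degrees.\<close>

theorem theorem6p4:
  fixes n m s i :: nat
    and P :: "nat \<Rightarrow> ('k::{alg_closed_field, field_char_0}, 'n::finite, 'm::finite) bipoint"
    and \<mu> \<mu>' :: "nat \<Rightarrow> nat"
    and IZ IZ' :: "('k, 'n, 'm) bipoly set"
    and F :: "nat \<Rightarrow> bideg list"
    and \<delta> :: "nat \<Rightarrow> (nat \<Rightarrow> ('k, 'n, 'm) bipoly) \<Rightarrow> (nat \<Rightarrow> ('k, 'n, 'm) bipoly)"
    and le_deg :: "bideg rel"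
    and ds :: "bideg list"
  assumes "n \<ge> 1" and "m \<ge> 1"
    and "CARD('n) = n + 1" and "CARD('m) = m + 1"
    and "\<And>j. j \<in> {1..s} \<Longrightarrow> P j \<in> biproj_space"
    and "inj_on P {1..s}"
    and "\<And>j. j \<in> {1..s} \<Longrightarrow> \<mu> j > 0"
    and "i \<in> {1..s}"
    and "\<mu>' = \<mu>(i := \<mu> i - 1)"
    and "IZ = fat_ideal s P \<mu>" and "IZ' = fat_ideal s P \<mu>'"
    and "ACM IZ"
    and "minimal_free_resolution IZ F \<delta>"
    and "ACM IZ'"
    and "linear_order le_deg"
    and "separators_degree le_deg IZ IZ' ds"
  shows "(\<forall>j>n + m. F j = []) \<and>
    (\<exists>F' (\<phi> :: (nat \<Rightarrow> ('k, 'n, 'm) bipoly) \<Rightarrow> (nat \<Rightarrow> ('k, 'n, 'm) bipoly)).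
      bigraded_iso (F (n + m)) (map (\<lambda>d. d + (n, m)) ds @ F') \<phi>)"
proof -
  note P = assms(5) and IZ = assms(10) and IZ' = assms(11)[unfolded assms(9)] and res = assms(13)
  have "\<exists>\<kappa>. \<forall>j\<in>{1..s}. avoids \<kappa> (P j)" by (rule exists_avoiding[OF P])
  then obtain \<kappa> where \<kappa>: "\<And>j. j \<in> {1..s} \<Longrightarrow> avoids \<kappa> (P j)" by blast
  let ?l = "lin_form isl \<kappa> :: bool \<Rightarrow> ('k, 'n, 'm) bipoly"
  have sub: "idl.subspace IZ" "idl.subspace IZ'"
    unfolding IZ IZ' by (rule fat_ideal_subspace[OF P \<kappa>]; assumption)+
  have hom: "homogeneous IZ" unfolding IZ by (rule fat_ideal_homogeneous[OF P \<kappa>])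
  have nz: "nzd IZ (?l \<beta>)" "nzd IZ' (?l \<beta>)" for \<beta>
    unfolding IZ IZ' by (rule fat_ideal_nzd[OF P \<kappa>]; assumption)+
  have nz2: "nzd (idl.span (insert (?l True) IZ)) (?l False)" "nzd (idl.span (insert (?l True) IZ')) (?l False)"
    using assms(12,14) fat_ideal_regular[OF P \<kappa>] unfolding ACM_def IZ IZ' by simp_all
  obtain \<sigma> q p where \<sigma>: "coords \<sigma>" and q: "\<And>\<beta>. isl (q \<beta>) = \<beta>" "\<And>\<beta>. \<sigma> (q \<beta>) = ?l \<beta>"
    and form: "\<And>v. \<sigma> v \<in> forms (var_deg v)" and Pi: "point_ideal (P i) = idl.span (\<sigma> ` {v. v \<noteq> q (isl v)})"
    and "\<And>v. var v - cst (p v) * ?l (isl v) \<in> point_ideal (P i)"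
    by (rule point_coords[OF P[OF assms(8)] \<kappa>[OF assms(8)]], rule that)
  obtain ws where ws: "set ws = {v. v \<noteq> q (isl v)}" "distinct ws" using finite_distinct_list[of "{v. v \<noteq> q (isl v)}"] by auto
  define zs where "zs = map \<sigma> ws"
  have len: "length zs = n + m"
    using sum_var_deg(1)[OF q(1) assms(3,4)] distinct_card[OF ws(2)] by (simp add: zs_def ws(1))
  let ?S = "{?l True, ?l False}"
  \<comment> \<open>Stated for a set \<open>V\<close> of pivots to cover both uses: \<open>V\<close>
    is empty for building chains and consists of both pivots for the descent and for the vanishing
    of F.\<close>
  have nzd_zs: "nzd (idl.span (\<sigma> ` V \<union> set (take r zs))) (zs ! r)"
    if "r < length zs" "V \<subseteq> {q True, q False}" for r V
  proof -
    have r: "r < length ws" "zs ! r = \<sigma> (ws ! r)" using that(1) by (simp_all add: zs_def)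
    have "ws ! r \<in> set ws" using r(1) by simp
    then have "ws ! r \<notin> V" using that(2) ws(1) q(1) by auto
    moreover have "ws ! r \<notin> set (take r ws)"
      using ws(2) r(1) by (auto simp: in_set_conv_nth nth_eq_iff_index_eq)
    ultimately have "nzd (idl.span (\<sigma> ` (V \<union> set (take r ws)))) (\<sigma> (ws ! r))"
      by (intro coords_nzd_span[OF \<sigma>]) simp
    then show ?thesis by (simp add: r zs_def image_Un take_map)
  qed
  have S: "?S = \<sigma> ` {q True, q False}" by (simp add: q(2))
  have S_zs: "idl.span (?S \<union> set zs) = idl.span (range var)"
  proof -
    have "{q True, q False} \<union> set ws = UNIV" unfolding ws(1) by (auto split: if_splits) (metis (full_types))
    then have "?S \<union> set zs = range \<sigma>" unfolding S zs_def set_map image_Un[symmetric] by (rule arg_cong)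
    then show ?thesis using coords_span_range[OF \<sigma>] by simp
  qed
  have vanish: "\<forall>j>n + m. F j = []"
  proof -
    \<comment> \<open>The ideals run through 0, (l_1), (l_1, l_2) without loss of exactness, and
      then each of the n + m elements of \<open>zs\<close> costs one degree, ending at the
      irrelevant ideal.\<close>
    have "exact_mod F \<delta> (idl.span {}) 0" by (rule exact_mod_0[OF res sub(1)])
    moreover have "nzd (idl.span {}) (?l True)" using coords_nzd_span[OF \<sigma>, of "q True" "{}"] q(2) by simp
    ultimately have "exact_mod F \<delta> (idl.span (insert (?l True) (idl.span {}))) 0"
      using nz(1) sub(1) by (intro exact_mod_step_regular[OF res sub(1)])
        (simp_all add: insert_absorb idl.subspace_0 iffD2[OF idl.span_eq_iff])
    then have "exact_mod F \<delta> (idl.span {?l True}) 0" by (simp only: idl_span_insert_span)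
    moreover have "nzd (idl.span {?l True}) (?l False)"
      using coords_nzd_span[OF \<sigma>, of "q False" "{q True}"] q by (metis image_empty image_insert singletonD)
    moreover have "nzd (idl.span (IZ \<union> idl.span {?l True})) (?l False)"
    proof -
      have "idl.span (IZ \<union> idl.span {?l True}) = idl.span (insert (?l True) IZ)"
        by (simp add: idl_span_Un_span)
      then show ?thesis using nz2(1) by simp
    qed
    ultimately have "exact_mod F \<delta> (idl.span (insert (?l False) (idl.span {?l True}))) 0"
      by (rule exact_mod_step_regular[OF res sub(1) idl.subspace_span, rotated 2])
    then have "exact_mod F \<delta> (idl.span ?S) 0" by (simp add: idl_span_insert_span insert_commute)
    then have "exact_mod F \<delta> (idl.span (?S \<union> set (take (length zs) zs))) (0 + length zs)"
      by (rule exact_mod_list[OF res sub(1)]) (use nzd_zs[of _ "{q True, q False}"] S in auto)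
    then have "exact_mod F \<delta> (idl.span (range var)) (n + m)"
      unfolding take_all[OF order_refl] unfolding S_zs len by simp
    then show ?thesis using resolution_vanishes[OF res sub(1)] by blast
  qed
  obtain Fs where Fs: "distinct Fs" "minimal_separators IZ IZ' (set Fs)" "list_all2 (\<lambda>f d. f \<in> forms d) Fs ds"
    using assms(16) unfolding separators_degree_def by blast
  have sub': "IZ \<subseteq> IZ'" and kill: "\<And>z f. z \<in> point_ideal (P i) \<Longrightarrow> f \<in> IZ' \<Longrightarrow> z * f \<in> IZ"
    using fat_ideal_step[where P = P and \<mu> = \<mu>, OF assms(8) assms(7)[OF assms(8)] P \<kappa>] unfolding IZ IZ' by blast+
  have Fs_sub: "set Fs \<subseteq> IZ'"
    using Fs(2) idl.span_superset[of "IZ \<union> set Fs"]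
    unfolding minimal_separators_def quot_generators_iff[OF sub sub'] by auto
  define e where "e k = var_deg (ws ! k)" for k
  have sum_e: "(\<Sum>k<length zs. e k) = (n, m)"
  proof -
    have "(\<Sum>k<length zs. e k) = sum_list (map var_deg ws)"
      by (simp add: e_def zs_def sum_list_sum_nth atLeast0LessThan)
    also have "\<dots> = (\<Sum>v\<in>set ws. var_deg v)" by (rule sum_list_distinct_conv_sum_set[OF ws(2)])
    finally show ?thesis unfolding ws(1) sum_var_deg(2)[OF q(1) assms(3,4)] .
  qed
  have "\<exists>g. syzygy_chain F \<delta> zs (Fs ! k) g \<and> g (n + m) \<in> free_mod_part (F (n + m)) (ds ! k + (n, m))"
    if k: "k < length Fs" for k
  proof -
    have "Fs ! k \<in> forms (ds ! k)" using Fs(3) k by (simp add: list_all2_conv_all_nth)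
    moreover have "z * Fs ! k \<in> IZ" if "z \<in> set zs" for z
    proof (rule kill)
      show "z \<in> point_ideal (P i)" unfolding Pi using that ws(1) by (auto simp: zs_def intro: idl.span_base)
      show "Fs ! k \<in> IZ'" using Fs_sub k by auto
    qed
    moreover have "zs ! r \<in> forms (e r)" if "r < length zs" for r using form that by (simp add: zs_def e_def)
    moreover have "nzd (idl.span (set (take r zs))) (zs ! r)" if "r < length zs" for r
      using nzd_zs[OF that, of "{}"] by simp
    ultimately obtain g where "syzygy_chain F \<delta> zs (Fs ! k) g"
      "g (length zs) \<in> free_mod_part (F (length zs)) (ds ! k + (\<Sum>k<length zs. e k))"
      using syzygy_chain_exists[OF res sub(1), of zs e "Fs ! k" "ds ! k"] by blast
    then show ?thesis unfolding sum_e unfolding len by (intro exI conjI)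
  qed
  then obtain g where g: "syzygy_chain F \<delta> zs (Fs ! k) (g k)"
    "g k (n + m) \<in> free_mod_part (F (n + m)) (ds ! k + (n, m))" if "k < length Fs" for k by metis
  have len_ds: "length ds = length Fs" using Fs(3) by (simp add: list_all2_lengthD)
  let ?G = "map (\<lambda>d. d + (n, m)) ds"
  have "count (mset ?G) D \<le> count (mset (F (n + m))) D" for D
  proof -
    define A where "A = {k. k < length Fs \<and> ds ! k + (n, m) = D}"
    define B where "B = {u. u < length (F (n + m)) \<and> F (n + m) ! u = D}"
    have "{k. k < length ?G \<and> ?G ! k = D} = A" by (auto simp: A_def len_ds)
    then have cA: "count (mset ?G) D = card A" by (simp only: count_mset_nth)
    have cB: "count (mset (F (n + m))) D = card B" by (simp only: count_mset_nth B_def)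
    have fin: "finite A" "finite B" by (simp_all add: A_def B_def)
    have "card A \<le> card B"
    proof (rule ccontr)
      assume "\<not> card A \<le> card B"
      \<comment> \<open>The matrix consists of the constant terms of the last chain vectors in the
        coordinates of degree \<open>D\<close>. With more separators than such generators, its rows
        are dependent.\<close>
      then obtain c where c: "\<exists>k\<in>A. c k \<noteq> 0"
        "\<forall>u\<in>B. (\<Sum>k\<in>A. c k * Poly_Mapping.lookup (g k (n + m) u) 0) = 0"
        using exists_linear_relation[OF fin(2,1), of "\<lambda>k u. Poly_Mapping.lookup (g k (n + m) u) 0"] by auto
      let ?f = "\<Sum>k\<in>A. cst (c k) * Fs ! k" and ?g = "\<lambda>r u. \<Sum>k\<in>A. cst (c k) * g k r u"
      have chain: "syzygy_chain F \<delta> zs ?f ?g"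
        by (rule syzygy_chain_sum[OF res sub(1) fin(1)]) (auto simp: A_def g)
      have lookup: "Poly_Mapping.lookup (?g (n + m) u) 0 = (\<Sum>k\<in>A. c k * Poly_Mapping.lookup (g k (n + m) u) 0)" for u
        by (simp add: lookup_sum lookup_cst_times)
      have "?g (n + m) u \<in> idl.span (range var)" for u
        unfolding in_irrelevant_iff lookup
      proof (cases "u \<in> B")
        case True
        then show "(\<Sum>k\<in>A. c k * Poly_Mapping.lookup (g k (n + m) u) 0) = 0" using c(2) by blast
      next
        case False
        \<comment> \<open>Outside \<open>B\<close> the generator has a degree other than
          \<open>D\<close>, so a nonzero constant entry would have the wrong degree; beyond the rank
          the vector is zero.\<close>
        have "Poly_Mapping.lookup (g k (n + m) u) 0 = 0" if k: "k \<in> A" for k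
        proof (cases "u < length (F (n + m))")
          case True
          then show ?thesis
            using free_mod_part_lookup_0[of "g k (n + m)" "F (n + m)" D u] g(2)[of k] k False by (auto simp: A_def B_def)
        next
          case False
          then show ?thesis using g(2)[of k] k by (auto simp: A_def free_mod_part_def free_mod_def)
        qed
        then show "(\<Sum>k\<in>A. c k * Poly_Mapping.lookup (g k (n + m) u) 0) = 0" by (intro sum.neutral) simp
      qed
      then have "?f \<in> idl.span (IZ \<union> ?S)"
        by (intro syzygy_chain_descend[OF res sub(1) chain])
           (use nzd_zs[of _ "{q True, q False}"] S S_zs len in auto)
      \<comment> \<open>Chains are indexed by positions in \<open>Fs\<close>, but independence of
        separators is stated for sets. Since \<open>Fs\<close> is distinct, the coefficients can be
        transported.\<close>
      define A' where "A' = (\<lambda>k. Fs ! k) ` A"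
      have inj: "inj_on (\<lambda>k. Fs ! k) A"
        using Fs(1) by (auto simp: inj_on_def A_def nth_eq_iff_index_eq)
      obtain k0 where k0: "k0 \<in> A" "c k0 \<noteq> 0" using c(1) by blast
      have "\<forall>f\<in>A'. c (the_inv_into A (\<lambda>k. Fs ! k) f) = 0"
      proof (rule separators_independent[OF sub(1) hom sub(2) sub' _ _ nz(2) nz2(2) Fs(2)])
        show "A' \<subseteq> set Fs" by (auto simp: A'_def A_def)
        show "f \<in> forms (ds ! k0)" if "f \<in> A'" for f
        proof -
          obtain k where k: "k \<in> A" "f = Fs ! k" using \<open>f \<in> A'\<close> by (auto simp: A'_def)
          then have "ds ! k = ds ! k0" using k0(1) by (auto simp: A_def)
          then show ?thesis using Fs(3) k by (auto simp: list_all2_conv_all_nth A_def)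
        qed
        show "(\<Sum>f\<in>A'. cst (c (the_inv_into A (\<lambda>k. Fs ! k) f)) * f) \<in> idl.span (IZ \<union> ?S)"
          using \<open>?f \<in> _\<close> unfolding A'_def sum.reindex[OF inj] by (simp add: the_inv_into_f_f[OF inj])
      qed (rule lin_form_in_irrelevant)+
      then show False using k0 the_inv_into_f_f[OF inj] by (auto simp: A'_def)
    qed
    then show ?thesis by (simp only: cA cB)
  qed
  then have "mset ?G \<subseteq># mset (F (n + m))" by (rule mset_subset_eqI)
  then obtain M where "mset (F (n + m)) = mset ?G + M" by (auto simp: subset_mset.le_iff_add)
  moreover obtain F' where "mset F' = M" using ex_mset by blast
  ultimately have "mset (F (n + m)) = mset (?G @ F')" by simp
  then show ?thesis using bigraded_iso_permutation vanish by blast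
qed

end
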